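(* For every fixed integer $k\ge 2$, there is a polynomial time approximation scheme for \textsc{MinDisAgree}[$k$]: for every fixed $\varepsilon>0$ there is a randomized polynomial-time algorithm which, given a $\pm$-labeled complete graph, outputs with high probability a $k$-clustering whose number of disagreements is at most $(1+\varepsilon)\,\mathrm{OPT}$, where $\mathrm{OPT}$ is the minimum number of disagreements of any $k$-clustering.
   Context: Let $V$ be a finite set of $n$ vertices and let every unordered pair of distinct vertices (edge of the complete graph on $V$) be labeled either $+$ or $-$. A $k$-clustering is a partition of $V$ into at most $k$ parts (clusters). An edge is an agreement of a clustering if it is a $+$ edge with both endpoints in the same cluster or a $-$ edge with endpoints in different clusters; otherwise it is a disagreement. \textsc{MinDisAgree}[$k$] asks for a $k$-clustering minimizing the number of disagreements. *)

theory Defs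
  imports
    "HOL-Probability.Probability_Mass_Function"
    "HOL-Computational_Algebra.Polynomial"
    "HOL-Library.Disjoint_Sets"
begin

section \<open>Correlation clustering with at most $k$ clusters\<close>

datatype sign = Plus | Minus

definition edges :: "'a set \<Rightarrow> 'a set set" where
  "edges V = {e. e \<subseteq> V \<and> card e = 2}"

text \<open>A labeling is a function on unordered pairs; only its values on \<^term>\<open>edges V\<close> matter.\<close>

definition k_clusterings :: "nat \<Rightarrow> 'a set \<Rightarrow> 'a set set set" where
  "k_clusterings k V = {P. partition_on V P \<and> card P \<le> k}"

definition same_cluster :: "'a set set \<Rightarrow> 'a set \<Rightarrow> bool" where
  "same_cluster P e \<longleftrightarrow> (\<exists>C\<in>P. e \<subseteq> C)"

definition agreement :: "('a set \<Rightarrow> sign) \<Rightarrow> 'a set set \<Rightarrow> 'a set \<Rightarrow> bool" where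
  "agreement lab P e \<longleftrightarrow>
     lab e = Plus \<and> same_cluster P e \<or> lab e = Minus \<and> \<not> same_cluster P e"

definition disagreements :: "'a set \<Rightarrow> ('a set \<Rightarrow> sign) \<Rightarrow> 'a set set \<Rightarrow> nat" where
  "disagreements V lab P = card {e \<in> edges V. \<not> agreement lab P e}"

definition OPT :: "nat \<Rightarrow> 'a set \<Rightarrow> ('a set \<Rightarrow> sign) \<Rightarrow> nat" where
  "OPT k V lab = Min (disagreements V lab ` k_clusterings k V)"

lemma finite_k_clusterings: "finite V \<Longrightarrow> finite (k_clusterings k V)"
  by (rule finite_subset[of _ "Pow (Pow V)"]) (auto simp: k_clusterings_def partition_on_def)

lemma k_clusterings_nonempty:
  assumes "k \<ge> 1" shows "k_clusterings k V \<noteq> {}"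
proof (cases "V = {}")
  case True
  then have "{} \<in> k_clusterings k V" by (simp add: k_clusterings_def partition_on_def)
  then show ?thesis by blast
next
  case False
  then have "{V} \<in> k_clusterings k V"
    using assms by (auto simp: k_clusterings_def partition_on_def disjoint_def)
  then show ?thesis by blast
qed


section \<open>Randomized polynomial time\<close>

text \<open>
  The machine model is a structured random access machine with fair coins. Every name denotes
  an unbounded array of natural numbers (cell 0 of an array serves as a scalar variable).
  The only arithmetic is addition and truncated subtraction: since multiplication is not
  available at unit cost, after \<open>t\<close> steps all numbers have \<open>O(t)\<close> bits more than those of the
  input, so that unit-cost polynomial time coincides with polynomial time on (probabilistic)
  Turing machines.
\<close>

type_synonym store = "string \<Rightarrow> nat \<Rightarrow> nat"

datatype expr =
    Num nat
  | Cell string expr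
  | Add expr expr
  | Sub expr expr

primrec val :: "expr \<Rightarrow> store \<Rightarrow> nat" where
  "val (Num m) s = m"
| "val (Cell x e) s = s x (val e s)"
| "val (Add e f) s = val e s + val f s"
| "val (Sub e f) s = val e s - val f s"

definition put :: "store \<Rightarrow> string \<Rightarrow> nat \<Rightarrow> nat \<Rightarrow> store" where
  "put s x i v = s(x := (s x)(i := v))"

text \<open>\<open>Toss x e\<close> stores a fresh fair random bit in \<open>x[e]\<close>; conditions hold iff they are nonzero.\<close>

datatype com =
    Skip
  | Assign string expr expr
  | Toss string expr
  | Seq com com
  | Cond expr com com
  | While expr com

type_synonym config = "com \<times> store"

primrec step :: "com \<Rightarrow> store \<Rightarrow> config pmf" where
  "step Skip s = return_pmf (Skip, s)"
| "step (Assign x e f) s = return_pmf (Skip, put s x (val e s) (val f s))"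
| "step (Toss x e) s =
     map_pmf (\<lambda>b. (Skip, put s x (val e s) (of_bool b))) (bernoulli_pmf (1/2))"
| "step (Seq c d) s =
     (if c = Skip then return_pmf (d, s)
      else map_pmf (\<lambda>(c', s'). (Seq c' d, s')) (step c s))"
| "step (Cond e c d) s = return_pmf (if val e s \<noteq> 0 then c else d, s)"
| "step (While e c) s =
     return_pmf (if val e s \<noteq> 0 then Seq c (While e c) else Skip, s)"

text \<open>
  The distribution of the configuration after \<open>t\<close> steps. A configuration has halted when its
  command is \<^term>\<open>Skip\<close>; it then stays unchanged.
\<close>

primrec run :: "nat \<Rightarrow> config \<Rightarrow> config pmf" where
  "run 0 cf = return_pmf cf"
| "run (Suc t) cf = bind_pmf (step (fst cf) (snd cf)) (run t)"

definition halts_within :: "nat \<Rightarrow> com \<Rightarrow> store \<Rightarrow> bool" where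
  "halts_within t c s \<longleftrightarrow> (\<forall>cf \<in> set_pmf (run t (c, s)). fst cf = Skip)"

definition outcome :: "nat \<Rightarrow> com \<Rightarrow> store \<Rightarrow> store pmf" where
  "outcome t c s = map_pmf snd (run t (c, s))"


section \<open>Encoding of instances and clusterings\<close>

text \<open>
  The vertices are \<open>0, \<dots>, n - 1\<close>. The input consists of the number \<open>n\<close> and the row-major
  \<open>n \<times> n\<close> matrix that has entry 1 at the \<open>+\<close> edges and 0 elsewhere; all other cells are 0.
\<close>

definition instance_store :: "nat \<Rightarrow> (nat set \<Rightarrow> sign) \<Rightarrow> store" where
  "instance_store n lab = (\<lambda>x a.
     if x = ''n'' \<and> a = 0 then n
     else if x = ''label'' \<and> a < n * n \<and> a div n \<noteq> a mod n \<and> lab {a div n, a mod n} = Plus then 1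
     else 0)"

text \<open>Cell \<open>v\<close> of the array \<open>cluster\<close> holds a name of the cluster that contains vertex \<open>v\<close>.\<close>

definition output_clustering :: "nat \<Rightarrow> store \<Rightarrow> nat set set" where
  "output_clustering n s = (\<lambda>v. {u. u < n \<and> s ''cluster'' u = s ''cluster'' v}) ` {..<n}"

lemma partition_on_output_clustering: "partition_on {..<n} (output_clustering n s)"
  by (rule partition_onI) (auto simp: output_clustering_def disjnt_def)

end

theory Submission
  imports Defs
begin

text \<open>
  The algorithm is deterministic: it tries all values of a constant number of guesses in
  \<open>{0, ..., n + O(1)}\<close>, turns every guess into a clustering in polynomial time, and keeps the cheapest one.
  It remains to see that some guess leads to a clustering of cost at most \<open>(1 + \<epsilon>) OPT\<close>.

  If \<open>OPT \<ge> \<gamma> w\<^sup>2\<close> on the current set of \<open>w\<close> vertices, an additive error \<open>\<epsilon> \<gamma> w\<^sup>2\<close> is affordable. Starting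
  from an optimal labelling, one replaces the labels of one small chunk of vertices after the other, every
  vertex greedily with respect to a sample of constant size; for each chunk some sample is good enough,
  and the algorithm guesses it together with its labels.

  If \<open>OPT \<le> \<gamma> w\<^sup>2\<close>, pick a scale that separates large from small clusters. A large cluster contains a
  vertex with few disagreements, whose neighbourhood is almost the cluster; guessing these centers gives the
  cost of each placement up to a small multiple of \<open>w\<close>, uniformly in all vertices. A vertex placed greedily
  but not as in the optimum disagrees with a constant fraction of all vertices already in the
  optimum, so these vertices are few and the extra cost is a small fraction of \<open>OPT\<close>. The vertices that
  seem to belong to small clusters are handled recursively with fewer labels.
\<close>

section \<open>Loop programs\<close>

text \<open>If the optimum is far below \<open>w^2\<close>, a wrong placement can only be paid for
  by the optimum itself. This works when the old or the new cluster of the moved vertex has linear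
  size: the two placements together then cost at least that size. A move between two small clusters
  would leave no such trace. Therefore small clusters must be negligible compared with the error
  tolerated for the large ones, which is the reason for a gap between the scales, and they are not
  told apart at first: label \<open>k\<close> means both "not yet treated" and "in some small
  cluster". The largest cluster is always large, so each recursion has fewer labels left. One
  program text serves all levels of the recursion, hence the sample size is common to all of them:
  the existence results hold for all \<open>m\<close> from some \<open>m0\<close> on, with a number
  of stages independent of the instance. Since no coin is tossed, the outcome is a point
  distribution and the probability in question is 1.\<close>

datatype lcom =
    LSkip
  | LAssign string expr expr
  | LSeq lcom lcom
  | LCond expr lcom lcom
  | LFor string nat lcom

primrec asg :: "lcom \<Rightarrow> string set" where
  "asg LSkip = {}"
| "asg (LAssign x e f) = {x}"
| "asg (LSeq c d) = asg c \<union> asg d"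
| "asg (LCond e c d) = asg c \<union> asg d"
| "asg (LFor x K c) = insert x (asg c)"

primrec wf_loops :: "lcom \<Rightarrow> bool" where
  "wf_loops LSkip = True"
| "wf_loops (LAssign x e f) = True"
| "wf_loops (LSeq c d) = (wf_loops c \<and> wf_loops d)"
| "wf_loops (LCond e c d) = (wf_loops c \<and> wf_loops d)"
| "wf_loops (LFor x K c) = (x \<notin> asg c \<and> wf_loops c)"

abbreviation scalar :: "string \<Rightarrow> expr" where
  "scalar x \<equiv> Cell x (Num 0)"

definition bump :: "string \<Rightarrow> store \<Rightarrow> store" where
  "bump x s = put s x 0 (s x 0 + 1)"

text \<open>A loop bound is \<open>n\<close> plus a constant of the program text, so every program
  of this language terminates in polynomial time. The constant lets a counter run through guesses
  that exceed \<open>n\<close> slightly, such as labels and penalties.\<close>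

primrec sem :: "lcom \<Rightarrow> store \<Rightarrow> store" where
  "sem LSkip s = s"
| "sem (LAssign x e f) s = put s x (val e s) (val f s)"
| "sem (LSeq c d) s = sem d (sem c s)"
| "sem (LCond e c d) s = (if val e s \<noteq> 0 then sem c s else sem d s)"
| "sem (LFor x K c) s = ((\<lambda>s. bump x (sem c s)) ^^ (s ''n'' 0 + K)) (put s x 0 0)"

abbreviation loop_guard :: "string \<Rightarrow> nat \<Rightarrow> expr" where
  "loop_guard x K \<equiv> Sub (Add (scalar ''n'') (Num K)) (scalar x)"

abbreviation loop_incr :: "string \<Rightarrow> com" where
  "loop_incr x \<equiv> Assign x (Num 0) (Add (scalar x) (Num 1))"

primrec compile :: "lcom \<Rightarrow> com" where
  "compile LSkip = Skip"
| "compile (LAssign x e f) = Assign x e f"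
| "compile (LSeq c d) = Seq (compile c) (compile d)"
| "compile (LCond e c d) = Cond e (compile c) (compile d)"
| "compile (LFor x K c) =
     Seq (Assign x (Num 0) (Num 0)) (While (loop_guard x K) (Seq (compile c) (loop_incr x)))"

text \<open>An iteration costs 4 steps besides the body: the guard, the increment, and the removal
  of \<open>Skip\<close> from two sequential compositions. The 3 pays for the initial assignment,
  its sequential composition and the last guard. For a conditional, the sum serves as an upper bound
  for either branch.\<close>

primrec time :: "lcom \<Rightarrow> nat poly" where
  "time LSkip = 0"
| "time (LAssign x e f) = 1"
| "time (LSeq c d) = time c + time d + 1"
| "time (LCond e c d) = time c + time d + 1"
| "time (LFor x K c) = [:K, 1:] * (time c + 4) + 3"

section \<open>Correctness and running time of the compilation\<close>

lemma put_other: "x \<noteq> y \<Longrightarrow> put s x i v y = s y"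
  by (simp add: put_def)

lemma put_same: "put s x i v x = (s x)(i := v)"
  by (simp add: put_def)

lemma sem_frame: "x \<notin> asg c \<Longrightarrow> sem c s x = s x"
proof (induction c arbitrary: s)
  case (LFor y K c)
  have "((\<lambda>s. bump y (sem c s)) ^^ N) s' x = s' x" for N s'
    using LFor by (induction N) (auto simp: bump_def put_other)
  then show ?case using LFor.prems by (auto simp: put_other)
qed (auto simp: put_other)

text \<open>Compiled programs never toss, so their steps are point distributions and can be counted
  by a relation on configurations. Steps from \<open>Skip\<close> are excluded, which makes the
  count the true halting time.\<close>

inductive dsteps :: "nat \<Rightarrow> config \<Rightarrow> config \<Rightarrow> bool" where
  dsteps_0: "dsteps 0 cf cf"
| dsteps_Suc: "c \<noteq> Skip \<Longrightarrow> step c s = return_pmf cf1 \<Longrightarrow> dsteps t cf1 cf2 \<Longrightarrow> dsteps (Suc t) (c, s) cf2"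

lemma dsteps_trans: "dsteps t a b \<Longrightarrow> dsteps t' b c \<Longrightarrow> dsteps (t + t') a c"
  by (induction rule: dsteps.induct) (auto intro: dsteps.intros)

lemma dsteps_run: "dsteps t a b \<Longrightarrow> run t a = return_pmf b"
  by (induction rule: dsteps.induct) (auto simp: bind_return_pmf)

lemma dsteps_step: "c \<noteq> Skip \<Longrightarrow> step c s = return_pmf cf \<Longrightarrow> dsteps 1 (c, s) cf"
  using dsteps_Suc[OF _ _ dsteps_0] by simp

lemma dsteps_Seq_lift:
  "dsteps t a b \<Longrightarrow> dsteps t (Seq (fst a) d, snd a) (Seq (fst b) d, snd b)"
proof (induction rule: dsteps.induct)
  case (dsteps_Suc c s cf1 t cf2)
  have "step (Seq c d) s = return_pmf (Seq (fst cf1) d, snd cf1)"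
    using dsteps_Suc by (cases cf1) simp
  then show ?case using dsteps_Suc by (auto intro!: dsteps.dsteps_Suc)
qed (rule dsteps_0)

lemma dsteps_Seq:
  assumes "dsteps t (c, s) (Skip, s')" "dsteps t' (d, s') cf"
  shows "dsteps (t + t' + 1) (Seq c d, s) cf"
proof -
  have "dsteps t (Seq c d, s) (Seq Skip d, s')"
    using dsteps_Seq_lift[OF assms(1)] by simp
  moreover have "dsteps 1 (Seq Skip d, s') (d, s')"
    by (rule dsteps_step) auto
  ultimately have "dsteps (t + (1 + t')) (Seq c d, s) cf"
    using assms(2) dsteps_trans by blast
  then show ?thesis by (simp add: ac_simps)
qed

lemma run_Skip: "run t (Skip, s) = return_pmf (Skip, s)"
  by (induction t) (auto simp: bind_return_pmf)

lemma run_add: "run (t + t') cf = bind_pmf (run t cf) (run t')"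
  by (induction t arbitrary: cf) (auto simp: bind_return_pmf bind_assoc_pmf intro!: bind_pmf_cong)

lemma dsteps_run_le:
  assumes "dsteps t (c, s) (Skip, s')" "t \<le> T"
  shows "run T (c, s) = return_pmf (Skip, s')"
proof -
  have "run (t + (T - t)) (c, s) = return_pmf (Skip, s')"
    unfolding run_add dsteps_run[OF assms(1)] by (simp add: bind_return_pmf run_Skip)
  then show ?thesis using assms(2) by simp
qed

lemma dsteps_compile:
  assumes "wf_loops c" "''n'' \<notin> asg c"
  shows "\<exists>t \<le> poly (time c) (s ''n'' 0). dsteps t (compile c, s) (Skip, sem c s)"
  using assms
proof (induction c arbitrary: s)
  case LSkip
  then show ?case by (auto intro: dsteps_0)
next
  case (LAssign x e f)
  then show ?case by (auto intro!: exI[of _ 1] dsteps_step[simplified])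
next
  case (LSeq c d)
  \<comment> \<open>The time bound is a polynomial in the content of \<open>n\<close>, so the second
    command must find it unchanged.\<close>
  have n: "sem c s ''n'' = s ''n''" using LSeq.prems by (intro sem_frame) auto
  obtain t where t: "t \<le> poly (time c) (s ''n'' 0)" "dsteps t (compile c, s) (Skip, sem c s)"
    using LSeq.IH(1) LSeq.prems by fastforce
  obtain t' where t': "t' \<le> poly (time d) (s ''n'' 0)"
      "dsteps t' (compile d, sem c s) (Skip, sem d (sem c s))"
    using LSeq.IH(2)[of "sem c s"] LSeq.prems n by fastforce
  have "dsteps (t + t' + 1) (compile (LSeq c d), s) (Skip, sem (LSeq c d) s)"
    using dsteps_Seq[OF t(2) t'(2)] by simp
  moreover have "t + t' + 1 \<le> poly (time (LSeq c d)) (s ''n'' 0)" using t(1) t'(1) by simp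
  ultimately show ?case by blast
next
  case (LCond e c d)
  define b where "b = (if val e s \<noteq> 0 then c else d)"
  have "\<exists>t \<le> poly (time b) (s ''n'' 0). dsteps t (compile b, s) (Skip, sem b s)"
    using LCond.IH[of s] LCond.prems by (auto simp: b_def)
  then obtain t where t: "t \<le> poly (time b) (s ''n'' 0)" "dsteps t (compile b, s) (Skip, sem b s)"
    by blast
  have "dsteps 1 (compile (LCond e c d), s) (compile b, s)"
    by (rule dsteps_step) (auto simp: b_def)
  from dsteps_trans[OF this t(2)]
  have "dsteps (1 + t) (compile (LCond e c d), s) (Skip, sem (LCond e c d) s)"
    unfolding b_def by (auto split: if_splits)
  moreover have "1 + t \<le> poly (time (LCond e c d)) (s ''n'' 0)"
    using t(1) by (auto simp: b_def split: if_splits)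
  ultimately show ?case by blast
next
  case (LFor x K c)
  define n where "n = s ''n'' 0"
  define T where "T = poly (time c) n"
  let ?W = "While (loop_guard x K) (Seq (compile c) (loop_incr x))"
  let ?f = "\<lambda>s. bump x (sem c s)"
  have x: "x \<notin> asg c" "x \<noteq> ''n''" "''n'' \<notin> asg c" using LFor.prems by auto
  \<comment> \<open>Induction on the number \<open>j\<close> of iterations still to come, from an
    arbitrary store with a matching counter.\<close>
  have "\<exists>t \<le> j * (T + 4) + 1. dsteps t (?W, s') (Skip, (?f ^^ j) s')"
    if "s' ''n'' 0 = n" "s' x 0 + j = n + K" for j s'
    using that
  proof (induction j arbitrary: s')
    case 0
    have "dsteps 1 (?W, s') (Skip, s')"
      by (rule dsteps_step) (use 0 in auto)
    then show ?case by auto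
  next
    case (Suc j)
    obtain t where t: "t \<le> T" "dsteps t (compile c, s') (Skip, sem c s')"
      using LFor.IH[of s'] LFor.prems Suc.prems by (auto simp: T_def)
    have "dsteps (t + 1 + 1) (Seq (compile c) (loop_incr x), s') (Skip, ?f s')"
      by (rule dsteps_Seq[OF t(2)], rule dsteps_step) (auto simp: bump_def)
    moreover have "?f s' ''n'' 0 = n" "?f s' x 0 + j = n + K"
      using Suc.prems x by (auto simp: bump_def put_same put_other sem_frame)
    then obtain t' where t': "t' \<le> j * (T + 4) + 1" "dsteps t' (?W, ?f s') (Skip, (?f ^^ j) (?f s'))"
      using Suc.IH by blast
    ultimately have "dsteps ((t + 1 + 1) + t' + 1) (Seq (Seq (compile c) (loop_incr x)) ?W, s')
        (Skip, (?f ^^ j) (?f s'))"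
      using dsteps_Seq by blast
    moreover have "dsteps 1 (?W, s') (Seq (Seq (compile c) (loop_incr x)) ?W, s')"
      by (rule dsteps_step) (use Suc.prems in auto)
    ultimately have "dsteps (1 + ((t + 1 + 1) + t' + 1)) (?W, s') (Skip, (?f ^^ j) (?f s'))"
      using dsteps_trans by blast
    moreover have "(?f ^^ Suc j) s' = (?f ^^ j) (?f s')" by (simp del: funpow.simps add: funpow_Suc_right)
    moreover have "1 + ((t + 1 + 1) + t' + 1) \<le> Suc j * (T + 4) + 1"
      using t(1) t'(1) by simp
    ultimately show ?case by metis
  qed
  from this[of "put s x 0 0" "n + K"] obtain t where t: "t \<le> (n + K) * (T + 4) + 1"
    "dsteps t (?W, put s x 0 0) (Skip, (?f ^^ (n + K)) (put s x 0 0))"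
    using x by (auto simp: put_same put_other n_def)
  have "dsteps 1 (Assign x (Num 0) (Num 0), s) (Skip, put s x 0 0)"
    by (rule dsteps_step) auto
  from dsteps_Seq[OF this t(2)]
  have "dsteps (1 + t + 1) (compile (LFor x K c), s) (Skip, sem (LFor x K c) s)"
    by (simp add: n_def)
  moreover have "1 + t + 1 \<le> poly (time (LFor x K c)) (s ''n'' 0)"
    using t(1) by (simp add: T_def n_def algebra_simps)
  ultimately show ?case by blast
qed

lemma compile_outcome:
  assumes "wf_loops c" "''n'' \<notin> asg c" "s ''n'' 0 = n"
  shows "halts_within (poly (time c) n) (compile c) s"
    and "outcome (poly (time c) n) (compile c) s = return_pmf (sem c s)"
proof -
  obtain t where "t \<le> poly (time c) n" "dsteps t (compile c, s) (Skip, sem c s)"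
    using dsteps_compile[OF assms(1,2), of s] assms(3) by auto
  then have "run (poly (time c) n) (compile c, s) = return_pmf (Skip, sem c s)"
    using dsteps_run_le by blast
  then show "halts_within (poly (time c) n) (compile c) s"
    "outcome (poly (time c) n) (compile c) s = return_pmf (sem c s)"
    by (auto simp: halts_within_def outcome_def)
qed

text \<open>The frame property is built in: in each iteration the counter value and the variables
  foreign to the body are known, so an invariant mentions only what the loop computes.\<close>

lemma sem_LFor_inv:
  assumes "x \<notin> asg c" "''n'' \<notin> asg c" "x \<noteq> ''n''" "s ''n'' 0 + K = N"
    and "I 0 (put s x 0 0)"
    and "\<And>i s'. i < N \<Longrightarrow> (\<And>y. y \<noteq> x \<Longrightarrow> y \<notin> asg c \<Longrightarrow> s' y = s y) \<Longrightarrow> s' x 0 = i \<Longrightarrow> I i s'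
      \<Longrightarrow> I (Suc i) (bump x (sem c s'))"
  shows "I N (sem (LFor x K c) s)"
proof -
  define s0 where "s0 = put s x 0 0"
  let ?f = "\<lambda>s. bump x (sem c s)"
  have "I i ((?f ^^ i) s0) \<and> (?f ^^ i) s0 x 0 = i \<and>
      (\<forall>y. y \<noteq> x \<longrightarrow> y \<notin> asg c \<longrightarrow> (?f ^^ i) s0 y = s y)" if "i \<le> N" for i
    using that
  proof (induction i)
    case 0
    then show ?case using assms by (simp add: s0_def put_same put_other)
  next
    case (Suc i)
    then have "I (Suc i) (?f ((?f ^^ i) s0))" using assms(6)[of i "(?f ^^ i) s0"] by simp
    then show ?case using Suc assms(1) by (simp add: bump_def put_same put_other sem_frame)
  qed
  then show ?thesis using assms(4) by (auto simp: s0_def)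
qed

section \<open>Relabelling and sampling\<close>

text \<open>Models "equal or joined by a + edge". Reflexivity makes the diagonal free, so that
  \<open>pair_cost\<close>, which ranges over ordered pairs, is exactly twice the number of
  disagreements.\<close>

definition similarity :: "('a \<Rightarrow> 'a \<Rightarrow> bool) \<Rightarrow> bool" where
  "similarity e \<longleftrightarrow> (\<forall>u v. e u v = e v u) \<and> (\<forall>u. e u u)"

definition pair_cost :: "('a \<Rightarrow> 'a \<Rightarrow> bool) \<Rightarrow> 'a set \<Rightarrow> ('a \<Rightarrow> nat) \<Rightarrow> real" where
  "pair_cost e W P = (\<Sum>u\<in>W. \<Sum>v\<in>W. of_bool (e u v \<noteq> (P u = P v)))"

definition place_cost :: "('a \<Rightarrow> 'a \<Rightarrow> bool) \<Rightarrow> 'a set \<Rightarrow> ('a \<Rightarrow> nat) \<Rightarrow> 'a \<Rightarrow> nat \<Rightarrow> real" where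
  "place_cost e W P u i = (\<Sum>v\<in>W. of_bool (e u v \<noteq> (P v = i)))"

lemma pair_cost_place_cost: "pair_cost e W P = (\<Sum>u\<in>W. place_cost e W P u (P u))"
  by (simp add: pair_cost_def place_cost_def eq_commute)

lemma place_cost_nonneg: "0 \<le> place_cost e W P u i"
  unfolding place_cost_def by (intro sum_nonneg) auto

lemma pair_cost_nonneg: "0 \<le> pair_cost e W P"
  unfolding pair_cost_def by (intro sum_nonneg) auto

lemma pair_cost_mono:
  assumes "W' \<subseteq> W" "finite W"
  shows "pair_cost e W' P \<le> pair_cost e W P"
proof -
  have "pair_cost e W' P \<le> (\<Sum>u\<in>W'. \<Sum>v\<in>W. of_bool (e u v \<noteq> (P u = P v)))"
    unfolding pair_cost_def using assms by (intro sum_mono sum_mono2) auto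
  also have "\<dots> \<le> pair_cost e W P"
    unfolding pair_cost_def using assms by (intro sum_mono2) (auto intro!: sum_nonneg)
  finally show ?thesis .
qed

lemma pair_cost_cong:
  assumes "\<And>u. u \<in> W \<Longrightarrow> P u = P' u"
  shows "pair_cost e W P = pair_cost e W P'"
  unfolding pair_cost_def using assms by (intro sum.cong refl) auto

text \<open>To first order, relabelling costs the sum of the changes of single vertices, and each
  one counts in both orders. A correction arises only for two distinct relabelled vertices. The
  factor \<open>card T - 1\<close> matters: relabelling one vertex needs no correction.\<close>

lemma pair_cost_relabel:
  assumes "finite W" "T \<subseteq> W" and sym: "\<And>u v. e u v = e v u" and e_refl: "\<And>u. e u u"
    and out: "\<And>u. u \<in> W - T \<Longrightarrow> P' u = P u"
  shows "pair_cost e W P' - pair_cost e W P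
    \<le> 2 * (\<Sum>u\<in>T. place_cost e W P u (P' u) - place_cost e W P u (P u))
      + 2 * (real (card T) * (real (card T) - 1))"
proof -
  define f where "f P u v = (of_bool (e u v \<noteq> (P u = P v)) :: real)" for P :: "'a \<Rightarrow> nat" and u v
  \<comment> \<open>The change at the pair if only \<open>u\<close> were relabelled.\<close>
  define g where "g u v = (of_bool (e u v \<noteq> (P v = P' u)) :: real) - of_bool (e u v \<noteq> (P v = P u))" for u v
  have f_flip: "f P u v = of_bool (e u v \<noteq> (P v = P u))" for P :: "'a \<Rightarrow> nat" and u v
    by (auto simp: f_def)
  define d where "d u v = (of_bool (u \<in> T \<and> v \<in> T \<and> u \<noteq> v) :: real)" for u v
  have fT: "finite T" using assms finite_subset by blast
  have "f P' u v - f P u v \<le> g u v + g v u + 2 * d u v" if "u \<in> W" "v \<in> W" for u v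
  proof -
    have bounds: "0 \<le> f P u v" "f P u v \<le> 1" "f P' u v \<le> 1" for u v
      by (simp_all add: f_def)
    have lower: "- f P u v \<le> g u v" for u v by (simp add: g_def f_flip)
    have fsym: "f P v u = f P u v" "f P' v u = f P' u v"
      unfolding f_def by (simp_all add: sym[of v u] eq_commute)
    have keep: "P' x = P x" if "x \<notin> T" "x \<in> W" for x using that out by blast
    have half: "g x y = f P' x y - f P x y" if "y \<notin> T" "y \<in> W" for x y
      using keep[OF that] by (simp add: g_def f_flip)
    have zero: "g x y = 0" if "x \<notin> T" "x \<in> W" for x y
      using keep[OF that] by (simp add: g_def f_flip)
    have d0: "0 \<le> d u v" by (simp add: d_def)
    consider "u \<notin> T" | "v \<notin> T" | "u = v" | "u \<in> T" "v \<in> T" "u \<noteq> v" by blast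
    then show ?thesis
    proof cases
      case 1
      then show ?thesis using half[of u v] zero[of u v] fsym d0 that by simp
    next
      case 2
      then show ?thesis using half[of v u] zero[of v u] d0 that by simp
    next
      case 3
      then show ?thesis using e_refl[of u] d0 by (simp add: g_def f_def)
    next
      case 4
      \<comment> \<open>The pair changes by at most \<open>1 - f P u v\<close>, while the two
        first-order terms sum to at least \<open>- 2 * f P u v\<close>; a correction of 2 closes the
        gap because \<open>f P u v\<close> is at most 1.\<close>
      then have "d u v = 1" by (simp add: d_def)
      then show ?thesis using bounds[of u v] lower[of u v] lower[of v u] fsym by simp
    qed
  qed
  then have "(\<Sum>u\<in>W. \<Sum>v\<in>W. f P' u v - f P u v) \<le> (\<Sum>u\<in>W. \<Sum>v\<in>W. g u v + g v u + 2 * d u v)"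
    by (intro sum_mono) auto
  moreover have "(\<Sum>u\<in>W. \<Sum>v\<in>W. f P' u v - f P u v) = pair_cost e W P' - pair_cost e W P"
    by (simp add: pair_cost_def f_def sum_subtractf)
  moreover have "(\<Sum>u\<in>W. \<Sum>v\<in>W. g u v + g v u + 2 * d u v)
      = (\<Sum>u\<in>W. \<Sum>v\<in>W. g u v) + (\<Sum>u\<in>W. \<Sum>v\<in>W. g v u) + 2 * (\<Sum>u\<in>W. \<Sum>v\<in>W. d u v)"
    by (simp add: sum.distrib sum_distrib_left)
  moreover have "(\<Sum>u\<in>W. \<Sum>v\<in>W. g v u) = (\<Sum>u\<in>W. \<Sum>v\<in>W. g u v)"
    by (rule sum.swap)
  moreover have "(\<Sum>u\<in>W. \<Sum>v\<in>W. g u v)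
      = (\<Sum>u\<in>T. place_cost e W P u (P' u) - place_cost e W P u (P u))"
  proof -
    have "(\<Sum>u\<in>W. \<Sum>v\<in>W. g u v) = (\<Sum>u\<in>T. \<Sum>v\<in>W. g u v)"
      by (rule sum.mono_neutral_right) (use assms out in \<open>auto simp: g_def f_def intro!: sum.neutral\<close>)
    also have "\<dots> = (\<Sum>u\<in>T. place_cost e W P u (P' u) - place_cost e W P u (P u))"
      by (simp only: g_def place_cost_def sum_subtractf)
    finally show ?thesis .
  qed
  moreover have "(\<Sum>u\<in>W. \<Sum>v\<in>W. d u v) = real (card T) * (real (card T) - 1)"
  proof -
    have "(\<Sum>u\<in>W. \<Sum>v\<in>W. d u v) = (\<Sum>u\<in>T. \<Sum>v\<in>W. d u v)"
      by (rule sum.mono_neutral_right) (use assms in \<open>auto simp: d_def\<close>)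
    also have "\<dots> = (\<Sum>u\<in>T. real (card T) - 1)"
    proof (rule sum.cong[OF refl])
      fix u assume u: "u \<in> T"
      have "(\<Sum>v\<in>W. d u v) = real (card {v\<in>W. u \<in> T \<and> v \<in> T \<and> u \<noteq> v})"
        using assms(1) by (simp add: d_def of_bool_def sum.If_cases Int_def)
      also have "{v\<in>W. u \<in> T \<and> v \<in> T \<and> u \<noteq> v} = T - {u}" using u assms(2) by auto
      also have "real (card (T - {u})) = real (card T) - 1"
        using card_Suc_Diff1[OF fT u] by linarith
      finally show "(\<Sum>v\<in>W. d u v) = real (card T) - 1" .
    qed
    finally show ?thesis by simp
  qed
  ultimately show ?thesis by simp
qed

text \<open>
  The sample is chosen greedily: since the deviations sum to zero over \<open>W\<close>, some next sample
  point has nonpositive inner product with the accumulated deviation.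
\<close>

lemma good_sample_exists:
  fixes h :: "'a \<Rightarrow> 'b \<Rightarrow> real" and \<mu> :: "'b \<Rightarrow> real" and m :: nat
  assumes "finite W" "W \<noteq> {}" "finite J"
    and h: "\<And>v j. v \<in> W \<Longrightarrow> j \<in> J \<Longrightarrow> 0 \<le> h v j \<and> h v j \<le> 1"
    and \<mu>: "\<And>j. j \<in> J \<Longrightarrow> \<mu> j * card W = (\<Sum>v\<in>W. h v j)"
  shows "\<exists>s. (\<forall>i. s i \<in> W) \<and>
    (\<Sum>j\<in>J. ((\<Sum>i<m. h (s i) j) - m * \<mu> j)\<^sup>2) \<le> m * card J"
proof (induction m)
  case 0
  then show ?case using assms(2) by auto
next
  case (Suc m)
  from Suc.IH obtain s where s: "\<And>i. s i \<in> W"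
    and dev: "(\<Sum>j\<in>J. ((\<Sum>i<m. h (s i) j) - m * \<mu> j)\<^sup>2) \<le> m * card J" by auto
  define X where "X j = (\<Sum>i<m. h (s i) j) - m * \<mu> j" for j
  have card: "card W > 0" using assms by (simp add: card_gt_0_iff)
  have \<mu>01: "0 \<le> \<mu> j \<and> \<mu> j \<le> 1" if "j \<in> J" for j
  proof -
    have "0 \<le> \<mu> j * card W" unfolding \<mu>[OF that] using h that by (intro sum_nonneg) auto
    moreover have "\<mu> j * card W \<le> 1 * card W"
      unfolding \<mu>[OF that] using h[OF _ that] sum_bounded_above[of W "\<lambda>v. h v j" 1] by auto
    ultimately show ?thesis using card by (simp add: zero_le_mult_iff)
  qed
  have "(\<Sum>v\<in>W. \<Sum>j\<in>J. X j * (h v j - \<mu> j)) = (\<Sum>j\<in>J. \<Sum>v\<in>W. X j * (h v j - \<mu> j))"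
    by (rule sum.swap)
  also have "\<dots> = 0"
  proof (rule sum.neutral, rule ballI)
    fix j assume "j \<in> J"
    have "(\<Sum>v\<in>W. X j * (h v j - \<mu> j)) = X j * ((\<Sum>v\<in>W. h v j) - card W * \<mu> j)"
      unfolding sum_distrib_left[symmetric] sum_subtractf by simp
    then show "(\<Sum>v\<in>W. X j * (h v j - \<mu> j)) = 0" using \<mu>[OF \<open>j \<in> J\<close>] by (simp add: mult.commute)
  qed
  finally have zero: "(\<Sum>v\<in>W. \<Sum>j\<in>J. X j * (h v j - \<mu> j)) = 0" .
  have "\<exists>v\<in>W. (\<Sum>j\<in>J. X j * (h v j - \<mu> j)) \<le> 0"
  proof (rule ccontr)
    assume "\<not> ?thesis"
    then have "\<And>v. v \<in> W \<Longrightarrow> 0 < (\<Sum>j\<in>J. X j * (h v j - \<mu> j))"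
      by (auto simp: not_le)
    then show False
      using sum_pos[OF assms(1,2), of "\<lambda>v. \<Sum>j\<in>J. X j * (h v j - \<mu> j)"] zero by simp
  qed
  then obtain v where v: "v \<in> W" "(\<Sum>j\<in>J. X j * (h v j - \<mu> j)) \<le> 0" by blast
  define s' where "s' = s(m := v)"
  have "(\<Sum>i<Suc m. h (s' i) j) - Suc m * \<mu> j = X j + (h v j - \<mu> j)" for j
    by (simp add: s'_def X_def algebra_simps)
  then have "((\<Sum>i<Suc m. h (s' i) j) - Suc m * \<mu> j)\<^sup>2
      = (X j)\<^sup>2 + 2 * (X j * (h v j - \<mu> j)) + (h v j - \<mu> j)\<^sup>2" for j
    by (simp only: power2_sum)
  then have "(\<Sum>j\<in>J. ((\<Sum>i<Suc m. h (s' i) j) - Suc m * \<mu> j)\<^sup>2)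
      = (\<Sum>j\<in>J. (X j)\<^sup>2 + 2 * (X j * (h v j - \<mu> j)) + (h v j - \<mu> j)\<^sup>2)"
    by (simp only:)
  also have "\<dots> = (\<Sum>j\<in>J. (X j)\<^sup>2) + 2 * (\<Sum>j\<in>J. X j * (h v j - \<mu> j)) + (\<Sum>j\<in>J. (h v j - \<mu> j)\<^sup>2)"
    by (simp add: sum.distrib sum_distrib_left)
  \<comment> \<open>The cross term is nonpositive, so each new sample point adds at most 1 per
    coordinate.\<close>
  also have "(\<Sum>j\<in>J. (h v j - \<mu> j)\<^sup>2) \<le> (\<Sum>j\<in>J. 1)"
  proof (rule sum_mono)
    fix j assume "j \<in> J"
    then have "\<bar>h v j - \<mu> j\<bar> \<le> 1" using h[OF v(1), of j] \<mu>01[of j] by auto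
    then show "(h v j - \<mu> j)\<^sup>2 \<le> 1" by (simp add: abs_square_le_1)
  qed
  finally have "(\<Sum>j\<in>J. ((\<Sum>i<Suc m. h (s' i) j) - Suc m * \<mu> j)\<^sup>2) \<le> Suc m * card J"
    using v(2) dev by (simp add: X_def algebra_simps)
  moreover have "\<forall>i. s' i \<in> W" using s v(1) by (simp add: s'_def)
  ultimately show ?case by blast
qed

text \<open>One sample is made good for all coordinates \<open>(u, i)\<close> in
  \<open>T \<times> A\<close> together, hence good on average over \<open>T\<close>. It is chosen
  before the rule \<open>r\<close>, since \<open>r\<close> will be whatever the program selects,
  including its ties.\<close>

lemma greedy_sample_exists:
  fixes \<theta> :: real and m :: nat
  assumes "finite W" "W \<noteq> {}" "T \<subseteq> W" "finite A" "\<And>u. u \<in> W \<Longrightarrow> P u \<in> A"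
    and "\<theta> > 0" "1 \<le> m * \<theta>\<^sup>2" "m > 0"
  shows "\<exists>s. (\<forall>i. s i \<in> W) \<and>
    (\<forall>r. (\<forall>u\<in>T. r u \<in> A \<and>
        (\<Sum>j<m. of_bool (e u (s j) \<noteq> (P (s j) = r u)))
          \<le> (\<Sum>j<m. of_bool (e u (s j) \<noteq> (P (s j) = P u)) :: real)) \<longrightarrow>
      (\<Sum>u\<in>T. place_cost e W P u (r u) - place_cost e W P u (P u))
        \<le> card W * (card T * card A * \<theta>))"
proof -
  define h where "h v = (\<lambda>(u, i). of_bool (e u v \<noteq> (P v = i)) :: real)" for v
  define \<mu> where "\<mu> = (\<lambda>(u, i). place_cost e W P u i / card W)"
  have card: "card W > 0" using assms by (simp add: card_gt_0_iff)
  have fT: "finite T" using assms finite_subset by blast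
  have mean: "\<mu> j * card W = (\<Sum>v\<in>W. h v j)" for j
    using card assms(2) by (cases j) (simp add: h_def \<mu>_def place_cost_def)
  have "\<exists>s. (\<forall>i. s i \<in> W) \<and>
    (\<Sum>j\<in>T \<times> A. ((\<Sum>i<m. h (s i) j) - m * \<mu> j)\<^sup>2) \<le> m * card (T \<times> A)"
    by (rule good_sample_exists)
      (use assms fT mean in \<open>auto simp: h_def\<close>)
  then obtain s where s: "\<And>i. s i \<in> W" and
    dev: "(\<Sum>j\<in>T \<times> A. ((\<Sum>i<m. h (s i) j) - m * \<mu> j)\<^sup>2) \<le> m * card (T \<times> A)" by blast
  define X where "X u i = (\<Sum>j<m. h (s j) (u, i)) - m * \<mu> (u, i)" for u i
  \<comment> \<open>Passage from squares to absolute values: \<open>2 * \<bar>X\<bar>\<close> is at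
    most \<open>\<theta> * X^2 + 1 / \<theta>\<close>, and \<open>1 / \<theta>\<close> is at most
    \<open>m * \<theta>\<close>. This weight balances the two terms against the bound on the
    squares.\<close>
  have "(\<Sum>u\<in>T. \<Sum>i\<in>A. \<bar>X u i\<bar>) \<le> (\<Sum>u\<in>T. \<Sum>i\<in>A. (\<theta> * (X u i)\<^sup>2 + m * \<theta>) / 2)"
  proof (intro sum_mono)
    fix u i
    have "0 \<le> (\<theta> * \<bar>X u i\<bar> - 1)\<^sup>2" by simp
    also have "\<dots> = \<theta>\<^sup>2 * (X u i)\<^sup>2 - 2 * \<theta> * \<bar>X u i\<bar> + 1"
      by (simp add: power2_diff power_mult_distrib)
    also have "\<dots> \<le> \<theta>\<^sup>2 * (X u i)\<^sup>2 - 2 * \<theta> * \<bar>X u i\<bar> + m * \<theta>\<^sup>2" using assms by simp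
    also have "\<dots> = \<theta> * (\<theta> * (X u i)\<^sup>2 + m * \<theta> - 2 * \<bar>X u i\<bar>)"
      by (simp add: algebra_simps power2_eq_square)
    finally show "\<bar>X u i\<bar> \<le> (\<theta> * (X u i)\<^sup>2 + m * \<theta>) / 2"
      using assms(6) by (simp add: zero_le_mult_iff)
  qed
  also have "\<dots> = (\<theta> * (\<Sum>u\<in>T. \<Sum>i\<in>A. (X u i)\<^sup>2) + card T * card A * (m * \<theta>)) / 2"
    by (simp add: sum_divide_distrib[symmetric] sum.distrib sum_distrib_left[symmetric])
  also have "(\<Sum>u\<in>T. \<Sum>i\<in>A. (X u i)\<^sup>2) \<le> m * (card T * card A)"
    using dev by (simp add: X_def sum.cartesian_product card_cartesian_product case_prod_unfold)
  finally have abs_dev: "(\<Sum>u\<in>T. \<Sum>i\<in>A. \<bar>X u i\<bar>) \<le> m * (card T * card A * \<theta>)"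
    using assms(6) by (simp add: algebra_simps)
  have "(\<Sum>u\<in>T. place_cost e W P u (r u) - place_cost e W P u (P u))
        \<le> card W * (card T * card A * \<theta>)"
    if r: "\<And>u. u \<in> T \<Longrightarrow> r u \<in> A" "\<And>u. u \<in> T \<Longrightarrow> (\<Sum>j<m. of_bool (e u (s j) \<noteq> (P (s j) = r u)))
          \<le> (\<Sum>j<m. of_bool (e u (s j) \<noteq> (P (s j) = P u)) :: real)" for r
  proof -
    have "m * (\<mu> (u, r u) - \<mu> (u, P u)) \<le> (\<Sum>i\<in>A. \<bar>X u i\<bar>)" if u: "u \<in> T" for u
    proof (cases "r u = P u")
      case True
      then show ?thesis by (simp add: sum_nonneg)
    next
      case False
      have "P u \<in> A" using assms u by blast
      have "(\<Sum>j<m. h (s j) (u, r u)) \<le> (\<Sum>j<m. h (s j) (u, P u))"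
        using r(2)[OF u] by (simp add: h_def)
      \<comment> \<open>The sample prefers \<open>r u\<close>, so the true means can prefer
        \<open>P u\<close> only by the deviations at these two labels.\<close>
      then have "m * (\<mu> (u, r u) - \<mu> (u, P u)) \<le> \<bar>X u (r u)\<bar> + \<bar>X u (P u)\<bar>"
        by (simp add: X_def algebra_simps)
      also have "\<dots> = (\<Sum>i\<in>{r u, P u}. \<bar>X u i\<bar>)" using False by simp
      also have "\<dots> \<le> (\<Sum>i\<in>A. \<bar>X u i\<bar>)"
        using r(1)[OF u] \<open>P u \<in> A\<close> assms(4) by (intro sum_mono2) auto
      finally show ?thesis .
    qed
    then have "(\<Sum>u\<in>T. m * (\<mu> (u, r u) - \<mu> (u, P u))) \<le> (\<Sum>u\<in>T. \<Sum>i\<in>A. \<bar>X u i\<bar>)"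
      by (rule sum_mono)
    also note abs_dev
    finally have "m * (\<Sum>u\<in>T. \<mu> (u, r u) - \<mu> (u, P u)) \<le> m * (card T * card A * \<theta>)"
      by (simp add: sum_distrib_left)
    then have "(\<Sum>u\<in>T. \<mu> (u, r u) - \<mu> (u, P u)) \<le> card T * card A * \<theta>"
      using assms(8) by simp
    then have "card W * (\<Sum>u\<in>T. \<mu> (u, r u) - \<mu> (u, P u)) \<le> card W * (card T * card A * \<theta>)"
      by (rule mult_left_mono) simp
    moreover have "card W * (\<Sum>u\<in>T. \<mu> (u, r u) - \<mu> (u, P u))
        = (\<Sum>u\<in>T. place_cost e W P u (r u) - place_cost e W P u (P u))"
      using card by (simp add: sum_distrib_left \<mu>_def right_diff_distrib)
    ultimately show ?thesis by simp
  qed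
  then show ?thesis using s by blast
qed

section \<open>Greedy labels, stages and guesses\<close>

primrec argmin_upto :: "nat \<Rightarrow> (nat \<Rightarrow> nat) \<Rightarrow> nat" where
  "argmin_upto 0 f = 0"
| "argmin_upto (Suc k) f = (if f (Suc k) < f (argmin_upto k f) then Suc k else argmin_upto k f)"

lemma argmin_upto_le: "argmin_upto k f \<le> k"
  by (induction k) auto

lemma argmin_upto_min: "i \<le> k \<Longrightarrow> f (argmin_upto k f) \<le> f i"
  by (induction k) (auto simp: le_Suc_eq)

lemma argmin_upto_cong: "(\<And>i. i \<le> k \<Longrightarrow> f i = h i) \<Longrightarrow> argmin_upto k f = argmin_upto k h"
proof (induction k)
  case (Suc k)
  then show ?case using argmin_upto_le[of k h] by simp
qed simp

text \<open>
  A labelling with values in \<open>{0..k}\<close> assigns \<open>k\<close> to the vertices that are still pending. The guesses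
  of a stage are stored with period 7: \<open>g (7 i)\<close> is a penalty for label \<open>i\<close> (0 or prohibitive),
  \<open>g (7 i + 1)\<close> is a center of cluster \<open>i\<close>, \<open>g (7 j + 2)\<close> and \<open>g (7 j + 3)\<close> are the \<open>j\<close>-th sample vertex
  and its label, \<open>g 4\<close> bounds the vertices that are placed, and the bit \<open>g 6\<close> switches the centers on.
\<close>

definition score :: "nat \<Rightarrow> nat \<Rightarrow> (nat \<Rightarrow> nat \<Rightarrow> bool) \<Rightarrow> nat \<Rightarrow> (nat \<Rightarrow> nat) \<Rightarrow> (nat \<Rightarrow> nat) \<Rightarrow> nat \<Rightarrow> nat \<Rightarrow> nat" where
  "score k m e n g Q u i =
     g (7 * i) + (\<Sum>j<m. of_bool (e u (g (7 * j + 2)) \<noteq> (g (7 * j + 3) = i)))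
     + g 6 * (\<Sum>x<n. of_bool (Q x = k \<and> e u x \<noteq> (i < k \<and> e (g (7 * i + 1)) x)))"

text \<open>Label \<open>k\<close> takes part in the minimum. With the centers on, its score counts
  the pending vertices similar to \<open>u\<close>, which is the cost of joining a negligible
  cluster; choosing it leaves \<open>u\<close> pending. A penalty rules it out where this is
  unwanted.\<close>

definition stage :: "nat \<Rightarrow> nat \<Rightarrow> (nat \<Rightarrow> nat \<Rightarrow> bool) \<Rightarrow> nat \<Rightarrow> (nat \<Rightarrow> nat) \<Rightarrow> (nat \<Rightarrow> nat) \<Rightarrow> nat \<Rightarrow> nat" where
  "stage k m e n g Q u =
     (if Q u = k \<and> u < n \<and> u < g 4 then argmin_upto k (score k m e n g Q u) else Q u)"

text \<open>Centers and sample vertices must index the label matrix, which nothing does if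
  \<open>n = 0\<close>. Other entries may exceed \<open>n\<close> by a constant, because a penalty
  has to beat the total \<open>n + m\<close> of the remaining terms of a score.\<close>

definition valid_guess :: "nat \<Rightarrow> nat \<Rightarrow> (nat \<Rightarrow> nat) \<Rightarrow> bool" where
  "valid_guess n K g \<longleftrightarrow> g 6 \<le> 1 \<and>
     (\<forall>i. g i < n + K \<and> (n = 0 \<or> g (7 * i + 1) < n \<and> g (7 * i + 2) < n))"

definition encode :: "(nat \<Rightarrow> nat) \<Rightarrow> (nat \<Rightarrow> nat) \<Rightarrow> (nat \<Rightarrow> nat) \<Rightarrow> (nat \<Rightarrow> nat) \<Rightarrow> nat \<Rightarrow> nat \<Rightarrow> nat \<Rightarrow> nat" where
  "encode pen c s l hi fl x =
     (let i = x div 7; r = x mod 7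
      in if r = 0 then pen i else if r = 1 then c i else if r = 2 then s i
         else if r = 3 then l i else if r = 4 then hi else if r = 5 then 0 else fl)"

lemma encode_simps [simp]:
  "encode pen c s l hi fl (7 * i) = pen i"
  "encode pen c s l hi fl (Suc (7 * i)) = c i"
  "encode pen c s l hi fl (Suc (Suc (7 * i))) = s i"
  "encode pen c s l hi fl (7 * i + 3) = l i"
  "encode pen c s l hi fl 4 = hi"
  "encode pen c s l hi fl 6 = fl"
proof -
  have "Suc (7 * i) div 7 = i" "Suc (7 * i) mod 7 = 1" "Suc (Suc (7 * i)) div 7 = i" "Suc (Suc (7 * i)) mod 7 = 2"
    "(7 * i + 3) div 7 = i" "(7 * i + 3) mod 7 = 3"
    by presburger+
  then show "encode pen c s l hi fl (7 * i) = pen i"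
    "encode pen c s l hi fl (Suc (7 * i)) = c i"
    "encode pen c s l hi fl (Suc (Suc (7 * i))) = s i"
    "encode pen c s l hi fl (7 * i + 3) = l i"
    "encode pen c s l hi fl 4 = hi"
    "encode pen c s l hi fl 6 = fl"
    by (simp_all add: encode_def Let_def)
qed

lemma valid_guess_encode:
  assumes "\<And>i. pen i < n + K" "\<And>i. c i < n" "\<And>i. s i < n" "\<And>i. l i < n + K" "hi < n + K" "fl \<le> 1" "K \<ge> 2"
  shows "valid_guess n K (encode pen c s l hi fl)"
proof -
  have "encode pen c s l hi fl x < n + K" for x
    using assms by (auto simp: encode_def Let_def intro: trans_less_add1)
  then show ?thesis using assms by (auto simp: valid_guess_def)
qed

lemma valid_guess_idle: "K \<ge> 1 \<Longrightarrow> valid_guess n K (\<lambda>_. 0)"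
  by (auto simp: valid_guess_def)

text \<open>Treats the guesses as nondeterministic choices, so that the existence arguments need not
  carry them along; \<open>reach_stages\<close> recovers them as data.\<close>

inductive reach :: "nat \<Rightarrow> nat \<Rightarrow> nat \<Rightarrow> (nat \<Rightarrow> nat \<Rightarrow> bool) \<Rightarrow> nat \<Rightarrow> nat \<Rightarrow> (nat \<Rightarrow> nat) \<Rightarrow> (nat \<Rightarrow> nat) \<Rightarrow> bool"
  for k m K e n where
  reach_0: "reach k m K e n 0 Q Q"
| reach_Suc: "valid_guess n K g \<Longrightarrow> reach k m K e n z (stage k m e n g Q) Q' \<Longrightarrow> reach k m K e n (Suc z) Q Q'"

lemma reach_trans:
  "reach k m K e n z Q Q' \<Longrightarrow> reach k m K e n z' Q' Q'' \<Longrightarrow> reach k m K e n (z + z') Q Q''"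
  by (induction rule: reach.induct) (auto intro: reach.intros)

text \<open>The zero guess has bound \<open>g 4 = 0\<close> and places nothing. Runs can thus be
  padded to the fixed number of stages of the program.\<close>

lemma reach_idle:
  assumes "K \<ge> 1" shows "reach k m K e n z Q Q"
proof (induction z)
  case (Suc z)
  have "stage k m e n (\<lambda>_. 0) Q = Q" by (auto simp: stage_def)
  then show ?case using Suc reach_Suc[OF valid_guess_idle[OF assms]] by metis
qed (rule reach_0)

lemma reach_mono:
  assumes "reach k m K e n z Q Q'" "z \<le> z'" "K \<ge> 1"
  shows "reach k m K e n z' Q Q'"
  using reach_trans[OF assms(1) reach_idle[OF assms(3), where z = "z' - z"]] assms(2) by simp

section \<open>Additive approximation\<close>

text \<open>A chunk of prescribed size can be described to the program by a single number.\<close>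

lemma threshold_exists:
  fixes U :: "nat set"
  assumes "U \<subseteq> {..<n}" "t \<le> card U"
  shows "\<exists>hi\<le>n. card {u\<in>U. u < hi} = t"
  using assms
proof (induction n arbitrary: U)
  case 0
  then show ?case by auto
next
  case (Suc n)
  have fU: "finite U" using Suc.prems finite_subset by blast
  show ?case
  proof (cases "t = card U")
    case True
    have "{u\<in>U. u < Suc n} = U" using Suc.prems by auto
    then show ?thesis using True by auto
  next
    case False
    then have "t \<le> card (U - {n})"
      using Suc.prems fU by (simp add: card_Diff_singleton_if) linarith
    moreover have "U - {n} \<subseteq> {..<n}" using Suc.prems by (auto simp: less_Suc_eq)
    ultimately obtain hi where "hi \<le> n" "card {u\<in>U - {n}. u < hi} = t" using Suc.IH by blast
    moreover have "{u\<in>U - {n}. u < hi} = {u\<in>U. u < hi}" using \<open>hi \<le> n\<close> by auto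
    ultimately show ?thesis by (metis le_SucI)
  qed
qed

text \<open>The guess supplies the labels of the sample vertices under \<open>P\<close>. These
  vertices may still be pending in \<open>Q\<close>, so their labels cannot be read off the current
  state.\<close>

lemma stage_sample:
  fixes \<theta> :: real
  assumes e: "similarity e" and W: "W \<subseteq> {..<n}" "W \<noteq> {}" and A: "A \<subseteq> {..<k}"
    and P: "\<And>u. u \<in> W \<Longrightarrow> P u \<in> A"
    and \<theta>: "\<theta> > 0" "1 \<le> m * \<theta>\<^sup>2" and m: "m > 0" and hi: "hi \<le> n"
    and T: "T = {u. u < n \<and> Q u = k \<and> u < hi}" "T \<subseteq> W"
  shows "\<exists>g. valid_guess n (k + m + 2) g \<and> (\<forall>u. u \<notin> T \<longrightarrow> stage k m e n g Q u = Q u)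
    \<and> (\<forall>u\<in>T. stage k m e n g Q u \<in> A)
    \<and> pair_cost e W (\<lambda>u. if u \<in> T then stage k m e n g Q u else P u)
      \<le> pair_cost e W P + 2 * (card W * (card T * card A * \<theta>)) + 2 * (real (card T) * (real (card T) - 1))"
proof -
  have fW: "finite W" and fA: "finite A" using W A finite_subset by blast+
  obtain s where s: "\<forall>i. s i \<in> W" and greedy: "\<forall>r. (\<forall>u\<in>T. r u \<in> A \<and>
        (\<Sum>j<m. of_bool (e u (s j) \<noteq> (P (s j) = r u)))
          \<le> (\<Sum>j<m. of_bool (e u (s j) \<noteq> (P (s j) = P u)) :: real)) \<longrightarrow>
      (\<Sum>u\<in>T. place_cost e W P u (r u) - place_cost e W P u (P u))
        \<le> card W * (card T * card A * \<theta>)"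
    using greedy_sample_exists[OF fW W(2) T(2) fA, of P \<theta> m e] P \<theta> m by blast
  \<comment> \<open>The sample contributes at most \<open>m\<close> to a score, so the penalty
    excludes all labels outside \<open>A\<close>, among them \<open>k\<close>. The centers are
    switched off, and \<open>s\<close> merely fills their slots.\<close>
  define g where "g = encode (\<lambda>i. if i \<in> A then 0 else n + m + 1) s s (\<lambda>j. P (s j)) hi 0"
  have n: "s i < n" "P (s i) < k" for i using s W P[of "s i"] A by auto
  have "P (s i) < n + (k + m + 2)" for i using n(2)[of i] by simp
  then have valid: "valid_guess n (k + m + 2) g"
    unfolding g_def using n(1) hi by (intro valid_guess_encode) auto
  define r where "r = stage k m e n g Q"
  have out: "r u = Q u" if "u \<notin> T" for u
    using that by (auto simp: r_def stage_def T g_def)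
  define f where "f u i = (\<Sum>j<m. of_bool (e u (s j) \<noteq> (P (s j) = i)) :: nat)" for u i
  have score: "score k m e n g Q u i = (if i \<in> A then 0 else n + m + 1) + f u i" for u i
    by (simp add: score_def g_def f_def)
  have best: "r u \<in> A \<and> f u (r u) \<le> f u (P u)" if u: "u \<in> T" for u
  proof -
    have r: "r u = argmin_upto k (score k m e n g Q u)"
      using u by (simp add: r_def stage_def T g_def)
    have a: "P u \<in> A" using P u T by auto
    then have "score k m e n g Q u (r u) \<le> score k m e n g Q u (P u)"
      unfolding r using A by (intro argmin_upto_min) auto
    then have *: "(if r u \<in> A then 0 else n + m + 1) + f u (r u) \<le> f u (P u)"
      using a by (simp add: score)
    moreover have "f u (P u) \<le> (\<Sum>j<m. 1)" unfolding f_def by (intro sum_mono) auto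
    ultimately show ?thesis by (auto split: if_splits)
  qed
  have "(\<Sum>u\<in>T. place_cost e W P u (r u) - place_cost e W P u (P u)) \<le> card W * (card T * card A * \<theta>)"
  proof (rule greedy[rule_format])
    fix u assume "u \<in> T"
    then have "real (f u (r u)) \<le> real (f u (P u))" "r u \<in> A" using best by auto
    then show "r u \<in> A \<and> (\<Sum>j<m. of_bool (e u (s j) \<noteq> (P (s j) = r u)))
          \<le> (\<Sum>j<m. of_bool (e u (s j) \<noteq> (P (s j) = P u)) :: real)"
      unfolding f_def of_nat_sum of_nat_of_bool by simp
  qed
  moreover have "pair_cost e W (\<lambda>u. if u \<in> T then r u else P u) - pair_cost e W P
    \<le> 2 * (\<Sum>u\<in>T. place_cost e W P u (if u \<in> T then r u else P u) - place_cost e W P u (P u))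
      + 2 * (real (card T) * (real (card T) - 1))"
    using e by (intro pair_cost_relabel[OF fW T(2)]) (auto simp: similarity_def)
  ultimately have "pair_cost e W (\<lambda>u. if u \<in> T then r u else P u)
      \<le> pair_cost e W P + 2 * (card W * (card T * card A * \<theta>)) + 2 * (real (card T) * (real (card T) - 1))"
    by simp
  then show ?thesis using valid out best unfolding r_def by blast
qed

text \<open>A hybrid argument: \<open>P\<close> agrees with the run on the vertices already placed
  and with the comparison labelling on the pending set \<open>U\<close>. Every stage judges its
  sample against the current hybrid, so the losses of the stages simply add up.\<close>

lemma reach_additive_aux:
  fixes \<theta> :: real and c :: nat
  assumes e: "similarity e" and W: "W \<subseteq> {..<n}" and A: "A \<subseteq> {..<k}"
    and \<theta>: "\<theta> > 0" "1 \<le> m * \<theta>\<^sup>2" and m: "m > 0" and c: "c \<ge> 1"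
    and U: "U = {u. u < n \<and> Q u = k}" "U \<subseteq> W" "card U \<le> z * c"
    and P: "\<And>u. u \<in> W \<Longrightarrow> P u \<in> A" "\<And>u. u \<in> W - U \<Longrightarrow> P u = Q u"
  shows "\<exists>Q'. reach k m (k + m + 2) e n z Q Q' \<and> (\<forall>u. u \<notin> U \<longrightarrow> Q' u = Q u) \<and> (\<forall>u\<in>U. Q' u \<in> A)
    \<and> pair_cost e W Q' \<le> pair_cost e W P
        + card U * (2 * (card W * (card A * \<theta>)) + 2 * (real c - 1))"
proof -
  have fW: "finite W" using finite_subset[OF W] by simp
  show ?thesis
    using U P
  proof (induction z arbitrary: U Q P)
    case 0
    have "finite U" using finite_subset[OF 0(2) fW] .
    then have empty: "U = {}" using 0(3) by simp
    have "pair_cost e W Q = pair_cost e W P"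
      by (rule pair_cost_cong) (simp add: 0(5) empty)
    then show ?case using empty by (intro exI[of _ Q]) (simp add: reach_0)
  next
    case (Suc z)
    note U = Suc.prems(1-3) and P = Suc.prems(4,5)
    have fU: "finite U" using finite_subset[OF U(2) fW] .
    show ?case
    proof (cases "W = {}")
      case True
      then have "U = {}" using U(2) by simp
      then show ?thesis using True
        by (intro exI[of _ Q]) (simp add: pair_cost_def reach_idle)
    next
      case False
      have "U \<subseteq> {..<n}" using U by auto
      \<comment> \<open>The last chunk may have fewer than \<open>c\<close> vertices, and later ones
        none.\<close>
      then obtain hi where hi: "hi \<le> n" "card {u\<in>U. u < hi} = min c (card U)"
        using threshold_exists[of U n "min c (card U)"] by auto
      define T where "T = {u\<in>U. u < hi}"
      have T: "T = {u. u < n \<and> Q u = k \<and> u < hi}" "T \<subseteq> W" "T \<subseteq> U" using U by (auto simp: T_def)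
      obtain g where g: "valid_guess n (k + m + 2) g" "\<And>u. u \<notin> T \<Longrightarrow> stage k m e n g Q u = Q u"
        "\<And>u. u \<in> T \<Longrightarrow> stage k m e n g Q u \<in> A"
        and cost: "pair_cost e W (\<lambda>u. if u \<in> T then stage k m e n g Q u else P u)
        \<le> pair_cost e W P + 2 * (card W * (card T * card A * \<theta>)) + 2 * (real (card T) * (real (card T) - 1))"
        using stage_sample[where P = P and A = A, OF e W False A P(1) \<theta> m hi(1) T(1,2)] by blast
      define Q1 where "Q1 = stage k m e n g Q"
      define P1 where "P1 = (\<lambda>u. if u \<in> T then Q1 u else P u)"
      \<comment> \<open>Labels in \<open>A\<close> are below \<open>k\<close>, so the chunk is no
        longer pending.\<close>
      have "Q1 u \<noteq> k" if "u \<in> T" for u using g(3)[OF that] A by (auto simp: Q1_def)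
      then have U1: "U - T = {u. u < n \<and> Q1 u = k}"
        using U(1) T(1) g(2) by (auto simp: Q1_def)
      have cT: "card T = min c (card U)" using hi by (simp add: T_def)
      have cU: "card (U - T) = card U - card T"
        using card_Diff_subset[OF finite_subset[OF T(3) fU] T(3)] .
      have "\<exists>Q'. reach k m (k + m + 2) e n z Q1 Q' \<and> (\<forall>u. u \<notin> U - T \<longrightarrow> Q' u = Q1 u) \<and> (\<forall>u\<in>U - T. Q' u \<in> A)
        \<and> pair_cost e W Q' \<le> pair_cost e W P1
          + card (U - T) * (2 * (card W * (card A * \<theta>)) + 2 * (real c - 1))"
      proof (rule Suc.IH[OF U1])
        show "card (U - T) \<le> z * c" using U(3) cT cU by simp
        show "P1 u \<in> A" if "u \<in> W" for u using that g(3) P(1) by (auto simp: P1_def Q1_def)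
        show "P1 u = Q1 u" if "u \<in> W - (U - T)" for u using that g(2) P(2) by (auto simp: P1_def Q1_def)
      qed (use U in auto)
      then obtain Q' where Q': "reach k m (k + m + 2) e n z Q1 Q'" "\<And>u. u \<notin> U - T \<Longrightarrow> Q' u = Q1 u"
        "\<And>u. u \<in> U - T \<Longrightarrow> Q' u \<in> A"
        and cost': "pair_cost e W Q' \<le> pair_cost e W P1
          + card (U - T) * (2 * (card W * (card A * \<theta>)) + 2 * (real c - 1))" by blast
      have "real (card T) * (real (card T) - 1) \<le> real (card T) * (real c - 1)"
        using cT by (intro mult_left_mono) auto
      then have "pair_cost e W P1 \<le> pair_cost e W P + card T * (2 * (card W * (card A * \<theta>)) + 2 * (real c - 1))"
        using cost[folded Q1_def, folded P1_def] by (simp add: algebra_simps)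
      moreover have "real (card U) = real (card T) + real (card (U - T))" using cU cT by simp
      moreover define B where "B = 2 * (card W * (card A * \<theta>)) + 2 * (real c - 1)"
      ultimately have "pair_cost e W Q' \<le> pair_cost e W P + card U * B"
        using cost' unfolding B_def[symmetric] by (simp add: distrib_right)
      then have "pair_cost e W Q' \<le> pair_cost e W P
          + card U * (2 * (card W * (card A * \<theta>)) + 2 * (real c - 1))"
        by (simp only: B_def)
      moreover have "Q' u = Q u" if "u \<notin> U" for u
        using that Q'(2) g(2) T(3) by (auto simp: Q1_def)
      moreover have "Q' u \<in> A" if "u \<in> U" for u
        using that Q'(2,3) g(3) by (cases "u \<in> T") (auto simp: Q1_def)
      moreover have "reach k m (k + m + 2) e n (Suc z) Q Q'"
        using reach_Suc[OF g(1)] Q'(1) by (simp add: Q1_def)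
      ultimately show ?thesis by blast
    qed
  qed
qed

text \<open>The sampling error and the corrections inside the chunks each get half of the allowed
  \<open>\<delta> * (card W)^2\<close>.\<close>

lemma reach_additive:
  fixes \<delta> :: real
  assumes "\<delta> > 0"
  shows "\<exists>m0 z. \<forall>m\<ge>m0. \<forall>n e Q A D W. similarity e \<longrightarrow> A \<subseteq> {..<k} \<longrightarrow> W = {u. u < n \<and> Q u = k} \<longrightarrow>
    (\<forall>u\<in>W. D u \<in> A) \<longrightarrow>
    (\<exists>Q'. reach k m (k + m + 2) e n z Q Q' \<and> (\<forall>u. u \<notin> W \<longrightarrow> Q' u = Q u) \<and> (\<forall>u\<in>W. Q' u \<in> A)
      \<and> pair_cost e W Q' \<le> pair_cost e W D + \<delta> * (card W)\<^sup>2)"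
proof -
  \<comment> \<open>At most \<open>k\<close> labels multiply \<open>\<theta>\<close>;
    \<open>k + 1\<close> keeps the quotient meaningful for \<open>k = 0\<close>.\<close>
  define \<theta> where "\<theta> = \<delta> / (4 * (k + 1))"
  define z where "z = nat \<lceil>4 / \<delta>\<rceil>"
  define m0 where "m0 = Suc (nat \<lceil>1 / \<theta>\<^sup>2\<rceil>)"
  have \<theta>: "\<theta> > 0" using assms by (simp add: \<theta>_def)
  have z: "4 / \<delta> \<le> z" "z > 0" using assms by (simp_all add: z_def real_nat_ceiling_ge)
  have main: "\<exists>Q'. reach k m (k + m + 2) e n z Q Q' \<and> (\<forall>u. u \<notin> W \<longrightarrow> Q' u = Q u) \<and> (\<forall>u\<in>W. Q' u \<in> A)
      \<and> pair_cost e W Q' \<le> pair_cost e W D + \<delta> * (card W)\<^sup>2"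
    if "m \<ge> m0" and e: "similarity e" and A: "A \<subseteq> {..<k}" and W: "W = {u. u < n \<and> Q u = k}"
      and D: "\<And>u. u \<in> W \<Longrightarrow> D u \<in> A" for m n e Q A D W
  proof -
    \<comment> \<open>Rounded up so that \<open>z\<close> chunks suffice. Only \<open>c - 1\<close>,
      at most \<open>card W / z\<close>, enters the error; a set with fewer than \<open>z\<close>
      vertices is treated one vertex at a time and pays no correction.\<close>
    define c where "c = Suc (card W div z)"
    have m: "m > 0" "1 \<le> m * \<theta>\<^sup>2"
    proof -
      show "m > 0" using \<open>m \<ge> m0\<close> by (simp add: m0_def)
      have "1 / \<theta>\<^sup>2 \<le> m0" unfolding m0_def by linarith
      also have "\<dots> \<le> m" using \<open>m \<ge> m0\<close> by simp
      finally show "1 \<le> m * \<theta>\<^sup>2" using \<theta> by (simp add: field_simps)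
    qed
    have "card W = card W div z * z + card W mod z" by (rule div_mult_mod_eq[symmetric])
    also have "\<dots> \<le> card W div z * z + z" using z(2) by (intro add_left_mono) simp
    also have "\<dots> = z * c" by (simp add: c_def)
    finally have "card W \<le> z * c" .
    have "\<exists>Q'. reach k m (k + m + 2) e n z Q Q' \<and> (\<forall>u. u \<notin> W \<longrightarrow> Q' u = Q u) \<and> (\<forall>u\<in>W. Q' u \<in> A) \<and>
      pair_cost e W Q' \<le> pair_cost e W D + card W * (2 * (card W * (card A * \<theta>)) + 2 * (real c - 1))"
      by (rule reach_additive_aux[where W = W and U = W and P = D, OF e _ A \<theta> m(2,1) _ W _ \<open>card W \<le> z * c\<close> D])
        (auto simp: W c_def)
    then obtain Q' where Q': "reach k m (k + m + 2) e n z Q Q'" "\<forall>u. u \<notin> W \<longrightarrow> Q' u = Q u" "\<forall>u\<in>W. Q' u \<in> A"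
      "pair_cost e W Q' \<le> pair_cost e W D + card W * (2 * (card W * (card A * \<theta>)) + 2 * (real c - 1))"
      by blast
    have "real (card A) * \<theta> \<le> k * \<theta>"
      using A \<theta> card_mono[OF _ A] by (intro mult_right_mono) auto
    also have "\<dots> \<le> \<delta> / 4" using assms by (simp add: \<theta>_def field_simps)
    finally have 1: "card W * (card A * \<theta>) \<le> card W * (\<delta> / 4)" by (intro mult_left_mono) auto
    have "real c - 1 \<le> card W / z" by (simp add: c_def of_nat_div_le_of_nat)
    also have "\<dots> \<le> card W / (4 / \<delta>)" using z assms by (intro divide_left_mono) auto
    finally have 2: "real c - 1 \<le> card W * (\<delta> / 4)" by simp
    have "card W * (2 * (card W * (card A * \<theta>)) + 2 * (real c - 1)) \<le> card W * (card W * \<delta>)"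
      using 1 2 by (intro mult_left_mono) auto
    then have "pair_cost e W Q' \<le> pair_cost e W D + \<delta> * (card W)\<^sup>2"
      using Q'(4) by (simp add: power2_eq_square algebra_simps)
    then show ?thesis using Q'(1-3) by blast
  qed
  show ?thesis
    by (rule exI[of _ m0], rule exI[of _ z], intro allI impI, rule main) (assumption | blast)+
qed

section \<open>Large clusters and their centers\<close>

text \<open>Whatever the sign of its edge to \<open>u\<close>, a member of cluster \<open>a\<close>
  or \<open>b\<close> disagrees with exactly one of the two placements.\<close>

lemma place_cost_two:
  assumes "finite W" "a \<noteq> b"
  shows "card {v\<in>W. P v = a} + card {v\<in>W. P v = b} \<le> place_cost e W P u a + place_cost e W P u b"
proof -
  have "real (card {v\<in>W. P v = i}) = (\<Sum>v\<in>W. of_bool (P v = i))" for i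
    using assms(1) by (simp add: Int_def conj_commute)
  then have "card {v\<in>W. P v = a} + card {v\<in>W. P v = b} = (\<Sum>v\<in>W. of_bool (P v = a) + of_bool (P v = b) :: real)"
    by (simp only: of_nat_add sum.distrib)
  also have "\<dots> \<le> (\<Sum>v\<in>W. of_bool (e u v \<noteq> (P v = a)) + of_bool (e u v \<noteq> (P v = b)))"
    using assms(2) by (intro sum_mono) auto
  also have "\<dots> = place_cost e W P u a + place_cost e W P u b"
    by (simp only: place_cost_def sum.distrib)
  finally show ?thesis .
qed

text \<open>By \<open>place_cost_two\<close> and near-greediness, a moved vertex already costs at
  least \<open>\<tau> * card W / 4\<close> in \<open>D\<close>. Hence the number of moved vertices
  times \<open>card W\<close> is bounded by a multiple of the optimum. The linear loss and the
  quadratic correction each stay below half of \<open>\<epsilon> * opt\<close>, and this is what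
  fixes the constants 32 and 64.\<close>

lemma pair_cost_near_greedy:
  fixes \<epsilon> \<tau> \<rho> \<gamma> :: real
  assumes e: "similarity e" and W: "finite W" "W \<noteq> {}"
    and large: "\<And>i. i \<in> L \<Longrightarrow> \<tau> * card W \<le> card {u\<in>W. D u = i}"
    and moved: "\<And>u. u \<in> W \<Longrightarrow> P u \<noteq> D u \<Longrightarrow> P u \<in> L \<or> D u \<in> L"
      "\<And>u. u \<in> W \<Longrightarrow> P u \<noteq> D u \<Longrightarrow> place_cost e W D u (P u) \<le> place_cost e W D u (D u) + 2 * \<rho> * card W"
    and cost: "pair_cost e W D \<le> \<gamma> * (card W)\<^sup>2"
    and \<epsilon>: "0 < \<epsilon>" "\<epsilon> \<le> 1" and \<tau>: "0 < \<tau>" and \<rho>: "0 \<le> \<rho>" "\<rho> \<le> \<epsilon> * \<tau> / 32" and \<gamma>: "\<gamma> \<le> \<epsilon> * \<tau>\<^sup>2 / 64"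
  shows "pair_cost e W P \<le> (1 + \<epsilon>) * pair_cost e W D"
proof -
  define M where "M = {u\<in>W. P u \<noteq> D u}"
  define w where "w = real (card W)"
  define \<mu> where "\<mu> = real (card M)"
  define opt where "opt = pair_cost e W D"
  have w: "w > 0" using W by (simp add: w_def card_gt_0_iff)
  have fM: "finite M" using W(1) by (simp add: M_def)
  have \<mu>: "\<mu> \<ge> 0" by (simp add: \<mu>_def)
  have opt: "opt \<ge> 0" by (simp add: opt_def pair_cost_nonneg)
  have "\<epsilon> * \<tau> \<le> 1 * \<tau>" using \<epsilon> \<tau> by (intro mult_right_mono) auto
  then have "\<rho> \<le> \<tau> / 4" using \<rho> \<tau> by linarith
  then have "\<rho> * w \<le> \<tau> / 4 * w" using w by (intro mult_right_mono) auto
  then have \<rho>w: "2 * \<rho> * w \<le> \<tau> * w / 2" by simp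
  have costly: "\<tau> * w / 4 \<le> place_cost e W D u (D u)" if "u \<in> M" for u
  proof -
    have u: "u \<in> W" "P u \<noteq> D u" using that by (auto simp: M_def)
    have "\<tau> * w \<le> card {v\<in>W. D v = P u} + card {v\<in>W. D v = D u}"
      using moved(1)[OF u] large[of "P u"] large[of "D u"] by (auto simp: w_def)
    also have "\<dots> \<le> place_cost e W D u (P u) + place_cost e W D u (D u)"
      using place_cost_two[OF W(1) u(2)] by simp
    also have "\<dots> \<le> 2 * place_cost e W D u (D u) + \<tau> * w / 2"
      using moved(2)[OF u] \<rho>w by (simp add: w_def)
    finally show ?thesis by simp
  qed
  have "\<mu> * (\<tau> * w / 4) = (\<Sum>u\<in>M. \<tau> * w / 4)" by (simp add: \<mu>_def)
  also have "\<dots> \<le> (\<Sum>u\<in>M. place_cost e W D u (D u))" using costly by (rule sum_mono)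
  also have "\<dots> \<le> opt"
    unfolding opt_def pair_cost_place_cost using W(1)
    by (intro sum_mono2) (auto simp: M_def place_cost_nonneg)
  finally have Mw: "\<tau> * (\<mu> * w) \<le> 4 * opt" by (simp add: algebra_simps)
  also have "\<dots> \<le> 4 * \<gamma> * (w * w)" using cost by (simp add: opt_def w_def power2_eq_square)
  \<comment> \<open>Together with the assumed bound on the cost of \<open>D\<close>, the moved
    vertices are a small fraction of \<open>W\<close>; this controls the quadratic term.\<close>
  finally have M: "\<tau> * \<mu> \<le> 4 * \<gamma> * w" using w by (simp add: mult.assoc[symmetric])
  have "0 \<le> \<tau> * \<mu>" using \<tau> \<mu> by simp
  also note M
  finally have \<gamma>0: "0 \<le> \<gamma>" using w by (simp add: zero_le_mult_iff)
  have "4 * \<rho> * (\<mu> * w) \<le> 4 * (\<epsilon> * \<tau> / 32) * (\<mu> * w)"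
    using \<rho> \<mu> w by (intro mult_right_mono) auto
  also have "\<dots> = \<epsilon> / 8 * (\<tau> * (\<mu> * w))" by simp
  also have "\<dots> \<le> \<epsilon> / 8 * (4 * opt)" using Mw \<epsilon> by (intro mult_left_mono) auto
  finally have first: "4 * \<rho> * (\<mu> * w) \<le> \<epsilon> * opt / 2" by simp
  have "\<tau>\<^sup>2 * (2 * \<mu>\<^sup>2) = 2 * (\<tau> * \<mu>) * (\<tau> * \<mu>)" by (simp add: power2_eq_square)
  also have "\<dots> \<le> 2 * (\<tau> * \<mu>) * (4 * \<gamma> * w)" using M \<tau> \<mu> by (intro mult_left_mono) auto
  also have "\<dots> = 8 * \<gamma> * (\<tau> * (\<mu> * w))" by simp
  also have "\<dots> \<le> 8 * \<gamma> * (4 * opt)" using Mw \<gamma>0 by (intro mult_left_mono) auto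
  also have "\<dots> = 32 * opt * \<gamma>" by simp
  also have "\<dots> \<le> 32 * opt * (\<epsilon> * \<tau>\<^sup>2 / 64)" using \<gamma> opt by (intro mult_left_mono) auto
  also have "\<dots> = \<tau>\<^sup>2 * (\<epsilon> * opt / 2)" by simp
  finally have second: "2 * \<mu>\<^sup>2 \<le> \<epsilon> * opt / 2" using \<tau> by simp
  have "pair_cost e W P - pair_cost e W D
    \<le> 2 * (\<Sum>u\<in>M. place_cost e W D u (P u) - place_cost e W D u (D u))
      + 2 * (real (card M) * (real (card M) - 1))"
    using e by (intro pair_cost_relabel[OF W(1)]) (auto simp: similarity_def M_def)
  also have "(\<Sum>u\<in>M. place_cost e W D u (P u) - place_cost e W D u (D u)) \<le> (\<Sum>u\<in>M. 2 * \<rho> * w)"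
    using moved(2) by (intro sum_mono) (auto simp: M_def w_def algebra_simps)
  also have "\<dots> = 2 * \<rho> * (\<mu> * w)" by (simp add: \<mu>_def)
  also have "2 * (real (card M) * (real (card M) - 1)) \<le> 2 * \<mu>\<^sup>2"
    by (simp add: \<mu>_def power2_eq_square algebra_simps)
  finally show ?thesis using first second by (simp add: opt_def algebra_simps)
qed

text \<open>The bound is independent of \<open>h\<close>, the row of the vertex to be placed: one
  approximation of a cluster serves all vertices uniformly.\<close>

lemma place_cost_perturb:
  fixes W :: "'a set" and h f g :: "'a \<Rightarrow> bool"
  shows "\<bar>(\<Sum>x\<in>W. of_bool (h x \<noteq> f x)) - (\<Sum>x\<in>W. of_bool (h x \<noteq> g x))\<bar> \<le> (\<Sum>x\<in>W. of_bool (f x \<noteq> g x) :: real)"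
proof -
  have "\<bar>\<Sum>x\<in>W. of_bool (h x \<noteq> f x) - of_bool (h x \<noteq> g x) :: real\<bar>
      \<le> (\<Sum>x\<in>W. \<bar>of_bool (h x \<noteq> f x) - of_bool (h x \<noteq> g x)\<bar>)" by (rule sum_abs)
  also have "\<dots> \<le> (\<Sum>x\<in>W. of_bool (f x \<noteq> g x))" by (rule sum_mono) auto
  finally show ?thesis by (simp only: sum_subtractf)
qed

text \<open>Averaging: the whole cost would be exceeded if each of the at least
  \<open>\<tau> * card W\<close> members of the cluster cost more than
  \<open>\<rho> * card W\<close>.\<close>

lemma center_exists:
  fixes \<tau> \<rho> :: real
  assumes W: "finite W" "W \<noteq> {}" and \<tau>: "0 < \<tau>"
    and i: "\<tau> * card W \<le> card {u\<in>W. D u = i}"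
    and cost: "pair_cost e W D \<le> \<rho> * \<tau> * (card W)\<^sup>2" and \<rho>: "0 \<le> \<rho>"
  shows "\<exists>v\<in>W. place_cost e W D v i \<le> \<rho> * card W"
proof (rule ccontr)
  assume "\<not> ?thesis"
  then have far: "\<And>v. v \<in> W \<Longrightarrow> \<rho> * card W < place_cost e W D v i" by (auto simp: not_le)
  define C where "C = {u\<in>W. D u = i}"
  have "card W > 0" using W by (simp add: card_gt_0_iff)
  then have "0 < \<tau> * card W" using \<tau> by simp
  then have C: "0 < card C" using i by (simp add: C_def)
  then have fC: "finite C" "C \<noteq> {}" by (auto simp: card_gt_0_iff)
  have "\<rho> * \<tau> * (card W)\<^sup>2 = (\<tau> * card W) * (\<rho> * card W)" by (simp add: power2_eq_square)
  also have "\<dots> \<le> card C * (\<rho> * card W)" using i \<rho> by (intro mult_right_mono) (auto simp: C_def)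
  also have "\<dots> = (\<Sum>v\<in>C. \<rho> * card W)" by simp
  also have "\<dots> < (\<Sum>v\<in>C. place_cost e W D v (D v))"
    using far by (intro sum_strict_mono fC) (auto simp: C_def)
  also have "\<dots> \<le> pair_cost e W D"
    unfolding pair_cost_place_cost using W(1)
    by (intro sum_mono2) (auto simp: C_def place_cost_nonneg)
  finally show False using cost by simp
qed

text \<open>The neighbourhood of a center stands in for a large cluster and the empty set for any
  small one. Either substitution errs by at most \<open>\<rho> * card W\<close>, so a comparison of
  two labels errs by at most twice that. The estimate cannot separate small labels, and accordingly
  the bound for a vertex left pending holds for every small \<open>b\<close>.\<close>

lemma stage_centers:
  fixes \<tau> \<rho> :: real
  assumes W: "W = {u. u < n \<and> Q u = k}" "W \<noteq> {}" and A: "A \<subseteq> {..<k}" "L \<subseteq> A"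
    and D: "\<forall>u\<in>W. D u \<in> A" and \<tau>: "0 < \<tau>" and \<rho>: "0 \<le> \<rho>"
    and large: "\<And>i. i \<in> L \<Longrightarrow> \<tau> * card W \<le> card {u\<in>W. D u = i}"
    and small: "\<And>i. i \<in> A - L \<Longrightarrow> card {u\<in>W. D u = i} \<le> \<rho> * card W"
    and cost: "pair_cost e W D \<le> \<rho> * \<tau> * (card W)\<^sup>2"
  shows "\<exists>g. valid_guess n (k + m + 2) g \<and> (\<forall>u. u \<notin> W \<longrightarrow> stage k m e n g Q u = Q u)
    \<and> (\<forall>u\<in>W. stage k m e n g Q u \<in> L \<or> stage k m e n g Q u = k \<and> A - L \<noteq> {})
    \<and> (\<forall>u\<in>W. \<forall>b\<in>A. stage k m e n g Q u = (if b \<in> L then b else k) \<longrightarrow>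
        place_cost e W D u b \<le> place_cost e W D u (D u) + 2 * \<rho> * card W)"
proof -
  have Wn: "W \<subseteq> {..<n}" using W by auto
  have fW: "finite W" using finite_subset[OF Wn] by simp
  \<comment> \<open>Indices without a large cluster also get a vertex, since a valid guess needs one
    in every center slot.\<close>
  have "\<forall>i. \<exists>v. v \<in> W \<and> (i \<in> L \<longrightarrow> place_cost e W D v i \<le> \<rho> * card W)"
    using center_exists[OF fW W(2) \<tau> large cost \<rho>] W(2) by blast
  then obtain c where c: "\<And>i. c i \<in> W" "\<And>i. i \<in> L \<Longrightarrow> place_cost e W D (c i) i \<le> \<rho> * card W"
    by metis
  obtain x0 where x0: "x0 \<in> W" using W(2) by blast
  \<comment> \<open>A vertex may stay pending only if some small label is left for it.\<close>
  define ok where "ok i \<longleftrightarrow> i \<in> L \<or> i = k \<and> A - L \<noteq> {}" for i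
  \<comment> \<open>The dummy sample label \<open>k + 1\<close> matches no candidate label, so the
    sample term is the same for all of them and drops out of the comparison.\<close>
  define g where "g = encode (\<lambda>i. if ok i then 0 else n + m + 1) c (\<lambda>_. x0) (\<lambda>_. k + 1) n 1"
  define r where "r = stage k m e n g Q"
  define est where "est u i = (\<Sum>x\<in>W. of_bool (e u x \<noteq> (i < k \<and> e (c i) x)) :: nat)" for u i
  define opt where "opt b = (if b \<in> L then b else k)" for b
  have valid: "valid_guess n (k + m + 2) g"
    unfolding g_def using c(1) x0 Wn by (intro valid_guess_encode) auto
  have out: "r u = Q u" if "u \<notin> W" for u
    using that by (auto simp: r_def stage_def W g_def)
  have sumW: "(\<Sum>x<n. of_bool (Q x = k \<and> B x)) = (\<Sum>x\<in>W. of_bool (B x) :: nat)" for B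
  proof -
    have "(\<Sum>x<n. of_bool (Q x = k \<and> B x)) = (\<Sum>x\<in>W. of_bool (Q x = k \<and> B x) :: nat)"
      by (rule sum.mono_neutral_right) (auto simp: W)
    also have "\<dots> = (\<Sum>x\<in>W. of_bool (B x))" by (rule sum.cong) (auto simp: W)
    finally show ?thesis .
  qed
  define c0 where "c0 u = (\<Sum>j<m. of_bool (e u x0) :: nat)" for u
  have score: "score k m e n g Q u i = (if ok i then 0 else n + m + 1) + c0 u + est u i" if "i \<le> k" for u i
    using that by (simp add: score_def g_def c0_def est_def sumW del: sum_of_bool_eq)
  have est_le: "est u i \<le> n" for u i
  proof -
    have "est u i \<le> (\<Sum>x\<in>W. 1)" unfolding est_def by (intro sum_mono) auto
    also have "\<dots> \<le> n" using card_mono[OF _ Wn] by simp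
    finally show ?thesis .
  qed
  have best: "ok (r u) \<and> (\<forall>a\<in>A. est u (r u) \<le> est u (opt a))" if u: "u \<in> W" for u
  proof -
    have r: "r u = argmin_upto k (score k m e n g Q u)"
      using u by (simp add: r_def stage_def W g_def)
    have rk: "r u \<le> k" unfolding r by (rule argmin_upto_le)
    have opt: "ok (opt a)" "opt a \<le> k" if "a \<in> A" for a
      using that A by (auto simp: ok_def opt_def)
    have le: "(if ok (r u) then 0 else n + m + 1) + est u (r u) \<le> est u (opt a)" if "a \<in> A" for a
    proof -
      have "score k m e n g Q u (r u) \<le> score k m e n g Q u (opt a)"
        unfolding r using opt[OF that] by (intro argmin_upto_min)
      then show ?thesis using opt[OF that] rk by (simp add: score)
    qed
    have "ok (r u)"
      using le[of "D u"] D u est_le[of u "opt (D u)"] by (auto split: if_splits)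
    then show ?thesis using le by auto
  qed
  have close: "\<bar>real (est u (opt a)) - place_cost e W D u a\<bar> \<le> \<rho> * card W" if a: "a \<in> A" for u a
  proof (cases "a \<in> L")
    case True
    then have "a < k" using A by auto
    then have "\<bar>real (est u (opt a)) - place_cost e W D u a\<bar> \<le> (\<Sum>x\<in>W. of_bool (e (c a) x \<noteq> (D x = a)))"
      using place_cost_perturb[where W = W and h = "e u" and f = "e (c a)" and g = "\<lambda>x. D x = a"] True
      by (simp add: est_def place_cost_def opt_def del: sum_of_bool_eq)
    also have "\<dots> \<le> \<rho> * card W" using c(2)[OF True] by (simp only: place_cost_def)
    finally show ?thesis .
  next
    case False
    have "\<bar>real (est u (opt a)) - place_cost e W D u a\<bar> \<le> (\<Sum>x\<in>W. of_bool (False \<noteq> (D x = a)))"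
      using place_cost_perturb[where W = W and h = "e u" and f = "\<lambda>_. False" and g = "\<lambda>x. D x = a"] False
      by (simp add: est_def place_cost_def opt_def del: sum_of_bool_eq)
    also have "\<dots> = card {x\<in>W. D x = a}" using fW by (simp add: Int_def)
    also have "\<dots> \<le> \<rho> * card W" using small a False by simp
    finally show ?thesis .
  qed
  have "place_cost e W D u b \<le> place_cost e W D u (D u) + 2 * \<rho> * card W"
    if "u \<in> W" "b \<in> A" "r u = opt b" for u b
  proof -
    have "D u \<in> A" using D that by blast
    then have "real (est u (opt b)) \<le> real (est u (opt (D u)))" using best[OF that(1)] that(3) by auto
    then show ?thesis using close[OF that(2), of u] close[OF \<open>D u \<in> A\<close>, of u] by linarith
  qed
  then have "\<forall>u\<in>W. \<forall>b\<in>A. r u = (if b \<in> L then b else k) \<longrightarrow>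
        place_cost e W D u b \<le> place_cost e W D u (D u) + 2 * \<rho> * card W"
    by (simp add: opt_def)
  moreover have "\<forall>u\<in>W. r u \<in> L \<or> r u = k \<and> A - L \<noteq> {}" using best by (simp add: ok_def)
  ultimately show ?thesis using valid out unfolding r_def by (intro exI[of _ g]) simp
qed

text \<open>Lets the recursion relabel \<open>W'\<close> without disturbing the cost of the
  remaining pairs.\<close>

lemma pair_cost_outside:
  assumes "finite W" "W' \<subseteq> W"
    and "\<And>u v. u \<in> W \<Longrightarrow> v \<in> W \<Longrightarrow> u \<notin> W' \<or> v \<notin> W' \<Longrightarrow> (Q u = Q v) = (P u = P v)"
  shows "pair_cost e W Q - pair_cost e W' Q = pair_cost e W P - pair_cost e W' P"
proof -
  define f where "f u v = (of_bool (e u v \<noteq> (Q u = Q v)) - of_bool (e u v \<noteq> (P u = P v)) :: real)" for u v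
  have zero: "f u v = 0" if "u \<in> W" "v \<in> W" "u \<notin> W' \<or> v \<notin> W'" for u v
    using assms(3)[OF that] by (simp add: f_def)
  have diff: "pair_cost e V Q - pair_cost e V P = (\<Sum>u\<in>V. \<Sum>v\<in>V. f u v)" for V
    by (simp only: pair_cost_def f_def sum_subtractf)
  have "(\<Sum>u\<in>W. \<Sum>v\<in>W. f u v) = (\<Sum>u\<in>W'. \<Sum>v\<in>W. f u v)"
    using assms(1,2) zero by (intro sum.mono_neutral_right) auto
  also have "\<dots> = (\<Sum>u\<in>W'. \<Sum>v\<in>W'. f u v)"
    using assms(1,2) zero by (intro sum.cong[OF refl] sum.mono_neutral_right) auto
  finally show ?thesis using diff[of W] diff[of W'] by simp
qed

text \<open>Every strict inclusion adds an element of \<open>A\<close>, so \<open>card A + 1\<close>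
  consecutive ones are impossible.\<close>

lemma chain_stabilizes:
  assumes "finite A" "\<And>j. L j \<subseteq> A" "\<And>j. L j \<subseteq> L (Suc j)"
  shows "\<exists>j\<le>card A. L j = L (Suc j)"
proof (rule ccontr)
  assume "\<not> ?thesis"
  then have neq: "L j \<subset> L (Suc j)" if "j \<le> card A" for j using that assms(3)[of j] by blast
  have "j \<le> card (L j)" if "j \<le> Suc (card A)" for j
    using that
  proof (induction j)
    case (Suc j)
    have "card (L j) < card (L (Suc j))"
      using neq[of j] Suc.prems finite_subset[OF assms(2) assms(1)] by (intro psubset_card_mono) auto
    then show ?case using Suc by simp
  qed simp
  from this[of "Suc (card A)"] show False using card_mono[OF assms(1,2), of "Suc (card A)"] by simp
qed

text \<open>
  An arbitrary \<open>D\<close> rather than an optimal one makes the statement composable: the induction applies it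
  to the part of \<open>D\<close> that lives on the vertices left pending by the first stage.
\<close>

definition approximable :: "nat \<Rightarrow> nat \<Rightarrow> real \<Rightarrow> nat \<Rightarrow> nat \<Rightarrow> bool" where
  "approximable k r \<epsilon> m z \<longleftrightarrow> (\<forall>n e Q A D W. similarity e \<longrightarrow> A \<subseteq> {..<k} \<longrightarrow> card A \<le> r \<longrightarrow>
     W = {u. u < n \<and> Q u = k} \<longrightarrow> (\<forall>u\<in>W. D u \<in> A) \<longrightarrow>
     (\<exists>Q'. reach k m (k + m + 2) e n z Q Q' \<and> (\<forall>u. u \<notin> W \<longrightarrow> Q' u = Q u) \<and> (\<forall>u\<in>W. Q' u \<in> A)
       \<and> pair_cost e W Q' \<le> (1 + \<epsilon>) * pair_cost e W D))"

lemma approximableD: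
  assumes "approximable k r \<epsilon> m z" and inst: "similarity e" "A \<subseteq> {..<k}" "card A \<le> r"
    "W = {u. u < n \<and> Q u = k}" "\<forall>u\<in>W. D u \<in> A"
  shows "\<exists>Q'. reach k m (k + m + 2) e n z Q Q' \<and> (\<forall>u. u \<notin> W \<longrightarrow> Q' u = Q u) \<and> (\<forall>u\<in>W. Q' u \<in> A)
       \<and> pair_cost e W Q' \<le> (1 + \<epsilon>) * pair_cost e W D"
  using assms(1)[unfolded approximable_def, THEN spec[where x = n], THEN spec[where x = e],
    THEN spec[where x = Q], THEN spec[where x = A], THEN spec[where x = D], THEN spec[where x = W]]
    inst by (elim impE)

text \<open>Lower the threshold geometrically; the set of large labels grows and must be stable at
  some step, where no class size lies between \<open>\<kappa> * \<tau>\<close> and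
  \<open>\<tau>\<close> times \<open>card W\<close>. The lower bound on \<open>\<tau>\<close> is
  uniform over all instances, as the choice of a global \<open>\<gamma>\<close> requires.\<close>

lemma scale_gap_exists:
  fixes \<kappa> :: real
  assumes W: "finite W" "W \<noteq> {}" and A: "finite A" "card A \<le> k" and D: "\<forall>u\<in>W. D u \<in> A"
    and \<kappa>: "0 < \<kappa>" "\<kappa> \<le> 1"
  shows "\<exists>L (\<tau> :: real). L \<subseteq> A \<and> L \<noteq> {} \<and> \<kappa> ^ k / (real k + 1) \<le> \<tau> \<and>
    (\<forall>i\<in>L. \<tau> * card W \<le> card {u\<in>W. D u = i}) \<and> (\<forall>i\<in>A - L. card {u\<in>W. D u = i} \<le> \<kappa> * \<tau> * card W)"
proof -
  \<comment> \<open>At most \<open>k\<close> classes cover \<open>W\<close>, so one of them exceeds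
    the fraction \<open>1 / (k + 1)\<close>: the first threshold is already met.\<close>
  define \<tau> where "\<tau> j = \<kappa> ^ j / (real k + 1)" for j
  define L where "L j = {i\<in>A. \<tau> j * card W \<le> card {u\<in>W. D u = i}}" for j
  have w: "card W > 0" using W by (simp add: card_gt_0_iff)
  have \<tau>_Suc: "\<tau> (Suc j) = \<kappa> * \<tau> j" for j by (simp add: \<tau>_def)
  have \<tau>_mono: "\<tau> (Suc j) \<le> \<tau> j" for j
    using \<kappa> by (simp add: \<tau>_def divide_right_mono mult_left_le_one_le)
  have sub: "L j \<subseteq> A" for j by (auto simp: L_def)
  have mono: "L j \<subseteq> L (Suc j)" for j
  proof
    fix i assume "i \<in> L j"
    moreover have "\<tau> (Suc j) * card W \<le> \<tau> j * card W" using \<tau>_mono by (rule mult_right_mono) simp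
    ultimately show "i \<in> L (Suc j)" unfolding L_def by auto
  qed
  have L0: "L 0 \<noteq> {}"
  proof
    assume "L 0 = {}"
    then have lt: "card {u\<in>W. D u = i} \<le> card W / (real k + 1)" if "i \<in> A" for i
      using that by (force simp: L_def \<tau>_def not_le)
    have "W = (\<Union>i\<in>A. {u\<in>W. D u = i})" using D by auto
    then have "card W = card (\<Union>i\<in>A. {u\<in>W. D u = i})" by simp
    also have "\<dots> = (\<Sum>i\<in>A. card {u\<in>W. D u = i})"
      using W A by (intro card_UN_disjoint) auto
    finally have "real (card W) = (\<Sum>i\<in>A. real (card {u\<in>W. D u = i}))" by simp
    also have "\<dots> \<le> (\<Sum>i\<in>A. card W / (real k + 1))" using lt by (rule sum_mono)
    also have "\<dots> = card A * (card W / (real k + 1))" by simp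
    also have "\<dots> \<le> k * (card W / (real k + 1))" using A by (intro mult_right_mono) auto
    also have "\<dots> < card W" using w by (simp add: field_simps)
    finally show False by simp
  qed
  have L: "L j \<noteq> {}" for j using L0 mono by (induction j) blast+
  obtain j where j: "j \<le> card A" "L j = L (Suc j)" using chain_stabilizes[where L = L, OF A(1) sub mono] by blast
  have "\<kappa> ^ k \<le> \<kappa> ^ j" using \<kappa> j A by (intro power_decreasing) auto
  then have "\<kappa> ^ k / (real k + 1) \<le> \<tau> j" by (simp add: \<tau>_def divide_right_mono)
  moreover have "card {u\<in>W. D u = i} \<le> \<kappa> * \<tau> j * card W" if "i \<in> A - L j" for i
  proof -
    have "i \<notin> L (Suc j)" using that j by simp
    then show ?thesis using that by (simp add: L_def \<tau>_Suc)
  qed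
  ultimately show ?thesis using L sub by (intro exI[of _ "L j"] exI[of _ "\<tau> j"]) (auto simp: L_def add.commute)
qed

text \<open>Compares three labellings: \<open>D\<close>, the hybrid \<open>P\<close> made of the
  placed labels and small labels on the pending vertices, and the final \<open>Q2\<close>. One
  factor \<open>1 + \<epsilon>'\<close> leads from \<open>D\<close> to \<open>P\<close>, a second
  one, from the recursion, to \<open>Q2\<close>.\<close>

lemma approximable_step:
  fixes \<epsilon> \<epsilon>' :: real
  assumes IH: "approximable k r \<epsilon>' m z" and \<epsilon>: "0 < \<epsilon>'" "\<epsilon>' \<le> 1" "(1 + \<epsilon>') * (1 + \<epsilon>') \<le> 1 + \<epsilon>"
    and e: "similarity e" and A: "A \<subseteq> {..<k}" "card A \<le> Suc r"
    and W: "W = {u. u < n \<and> Q u = k}" "W \<noteq> {}" and D: "\<forall>u\<in>W. D u \<in> A"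
    and cost: "pair_cost e W D \<le> \<epsilon>' * ((\<epsilon>' / 32) ^ k / (real k + 1))\<^sup>2 / 64 * (card W)\<^sup>2"
  shows "\<exists>Q'. reach k m (k + m + 2) e n (Suc z) Q Q' \<and> (\<forall>u. u \<notin> W \<longrightarrow> Q' u = Q u) \<and> (\<forall>u\<in>W. Q' u \<in> A)
       \<and> pair_cost e W Q' \<le> (1 + \<epsilon>) * pair_cost e W D"
proof -
  have Wn: "W \<subseteq> {..<n}" using W by auto
  have fW: "finite W" using finite_subset[OF Wn] by simp
  have fA: "finite A" using finite_subset[OF A(1)] by simp
  \<comment> \<open>Chosen so that \<open>\<rho> = \<kappa> * \<tau>\<close> meets the requirement
    of \<open>pair_cost_near_greedy\<close>. As \<open>\<tau>\<close> depends on the instance,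
    \<open>\<gamma>\<close> is built from its lower bound \<open>\<tau>0\<close>.\<close>
  define \<kappa> where "\<kappa> = \<epsilon>' / 32"
  define \<tau>0 where "\<tau>0 = \<kappa> ^ k / (real k + 1)"
  define \<gamma> where "\<gamma> = \<epsilon>' * \<tau>0\<^sup>2 / 64"
  have \<kappa>: "0 < \<kappa>" "\<kappa> \<le> 1" using \<epsilon> by (simp_all add: \<kappa>_def)
  have "card A \<le> k" using card_mono[OF _ A(1)] by simp
  from scale_gap_exists[where D = D, OF fW W(2) fA this D \<kappa>]
  obtain L and \<tau> :: real where gap: "L \<subseteq> A \<and> L \<noteq> {} \<and> \<kappa> ^ k / (real k + 1) \<le> \<tau> \<and>
    (\<forall>i\<in>L. \<tau> * card W \<le> card {u\<in>W. D u = i}) \<and> (\<forall>i\<in>A - L. card {u\<in>W. D u = i} \<le> \<kappa> * \<tau> * card W)"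
    by (elim exE) (rule that)
  then have L: "L \<subseteq> A" "L \<noteq> {}" and \<tau>: "\<tau>0 \<le> \<tau>" by (simp_all add: \<tau>0_def)
  have large: "\<tau> * card W \<le> card {u\<in>W. D u = i}" if "i \<in> L" for i
    using gap that by blast
  have small: "card {u\<in>W. D u = i} \<le> \<kappa> * \<tau> * card W" if "i \<in> A - L" for i
    using gap that by blast
  have \<tau>0: "0 < \<tau>0" using \<kappa> by (simp add: \<tau>0_def)
  define \<rho> where "\<rho> = \<kappa> * \<tau>"
  have \<tau>_pos: "0 < \<tau>" using \<tau> \<tau>0 by simp
  have \<rho>: "0 \<le> \<rho>" "\<rho> \<le> \<epsilon>' * \<tau> / 32" using \<kappa> \<tau>_pos by (simp_all add: \<rho>_def \<kappa>_def)
  have sq: "\<tau>0\<^sup>2 \<le> \<tau>\<^sup>2" using \<tau> \<tau>0 by (intro power_mono) auto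
  then have "\<epsilon>' * \<tau>0\<^sup>2 \<le> \<epsilon>' * \<tau>\<^sup>2" using \<epsilon>(1) by (intro mult_left_mono) auto
  then have \<gamma>: "\<gamma> \<le> \<epsilon>' * \<tau>\<^sup>2 / 64" by (simp add: \<gamma>_def)
  also have "\<dots> \<le> \<rho> * \<tau>" using \<epsilon>(1) by (simp add: \<rho>_def \<kappa>_def power2_eq_square)
  finally have \<gamma>\<rho>: "\<gamma> \<le> \<rho> * \<tau>" .
  have cost': "pair_cost e W D \<le> \<gamma> * (card W)\<^sup>2" using cost by (simp only: \<gamma>_def \<tau>0_def \<kappa>_def)
  also have "\<dots> \<le> \<rho> * \<tau> * (card W)\<^sup>2" using \<gamma>\<rho> by (intro mult_right_mono) auto
  finally have "pair_cost e W D \<le> \<rho> * \<tau> * (card W)\<^sup>2" .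
  from stage_centers[where m = m and L = L and A = A and D = D, OF W A(1) L(1) D \<tau>_pos \<rho>(1) large small[folded \<rho>_def] this]
  obtain g where g: "valid_guess n (k + m + 2) g" and g_out: "\<And>u. u \<notin> W \<Longrightarrow> stage k m e n g Q u = Q u"
    and g_in: "\<And>u. u \<in> W \<Longrightarrow> stage k m e n g Q u \<in> L \<or> stage k m e n g Q u = k \<and> A - L \<noteq> {}"
    and g_cost: "\<And>u b. u \<in> W \<Longrightarrow> b \<in> A \<Longrightarrow> stage k m e n g Q u = (if b \<in> L then b else k) \<Longrightarrow>
        place_cost e W D u b \<le> place_cost e W D u (D u) + 2 * \<rho> * card W" by blast
  define Q1 where "Q1 = stage k m e n g Q"
  define W1 where "W1 = {u. u < n \<and> Q1 u = k}"
  have kL: "k \<notin> L" using L A by auto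
  have W1: "W1 \<subseteq> W"
  proof
    fix u assume "u \<in> W1"
    then show "u \<in> W" using g_out[of u] W(1) by (cases "u \<in> W") (auto simp: W1_def Q1_def)
  qed
  have Q1L: "Q1 u \<in> L" if "u \<in> W" "u \<notin> W1" for u
    using g_in[OF that(1)] that W(1) by (auto simp: W1_def Q1_def)
  have Q1k: "Q1 u = k" if "u \<in> W1" for u using that by (simp add: W1_def)
  have S: "A - L \<noteq> {}" if "u \<in> W1" for u
    using g_in[of u] W1 that Q1k[OF that] kL by (auto simp: Q1_def)
  \<comment> \<open>A pending vertex with a small label keeps it; one with a large label gets any
    small label, all of which are nearly greedy for it. So each moved vertex has a large label
    before or after the move.\<close>
  define D1 where "D1 u = (if D u \<in> A - L then D u else (SOME a. a \<in> A - L))" for u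
  have D1: "D1 u \<in> A - L" if "u \<in> W1" for u
    using some_in_eq[of "A - L"] S[OF that] by (auto simp: D1_def)
  define P where "P u = (if u \<in> W1 then D1 u else Q1 u)" for u
  have moved: "P u \<in> L \<or> D u \<in> L" if "u \<in> W" "P u \<noteq> D u" for u
    using that Q1L[of u] D by (auto simp: P_def D1_def split: if_splits)
  have moved_cost: "place_cost e W D u (P u) \<le> place_cost e W D u (D u) + 2 * \<rho> * card W"
    if "u \<in> W" "P u \<noteq> D u" for u
  proof (rule g_cost[OF that(1)])
    show "P u \<in> A" using D1[of u] Q1L[OF that(1)] L(1) by (auto simp: P_def)
    show "stage k m e n g Q u = (if P u \<in> L then P u else k)"
      unfolding Q1_def[symmetric] using D1[of u] Q1k[of u] Q1L[OF that(1)] by (simp add: P_def)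
  qed
  note near = pair_cost_near_greedy[where P = P and D = D and L = L,
    OF e fW W(2) large moved moved_cost cost' \<epsilon>(1,2) \<tau>_pos \<rho> \<gamma>]
  \<comment> \<open>The decrease of the induction, from \<open>L\<close> being nonempty.\<close>
  have "card (A - L) < card A" using L fA by (intro psubset_card_mono) auto
  then have "card (A - L) \<le> r" "A - L \<subseteq> {..<k}" using A by auto
  then obtain Q2 where Q2: "reach k m (k + m + 2) e n z Q1 Q2" "\<And>u. u \<notin> W1 \<Longrightarrow> Q2 u = Q1 u"
    "\<And>u. u \<in> W1 \<Longrightarrow> Q2 u \<in> A - L" and Q2_cost: "pair_cost e W1 Q2 \<le> (1 + \<epsilon>') * pair_cost e W1 D1"
    using approximableD[where D = D1, OF IH e _ _ W1_def] D1 by blast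
  \<comment> \<open>Labels on \<open>W1\<close> avoid \<open>L\<close> and labels outside
    \<open>W1\<close> lie in \<open>L\<close>, so pairs across are separated both in
    \<open>Q2\<close> and in \<open>P\<close>.\<close>
  have "pair_cost e W Q2 - pair_cost e W1 Q2 = pair_cost e W P - pair_cost e W1 P"
  proof (rule pair_cost_outside[OF fW W1])
    fix u v assume uv: "u \<in> W" "v \<in> W" "u \<notin> W1 \<or> v \<notin> W1"
    have lab: "Q2 x = P x \<and> P x \<in> L" if "x \<in> W" "x \<notin> W1" for x
      using Q2(2) that Q1L by (simp add: P_def)
    have lab1: "Q2 x \<notin> L \<and> P x \<notin> L" if "x \<in> W1" for x
      using Q2(3)[OF that] D1[OF that] that by (simp add: P_def)
    show "(Q2 u = Q2 v) = (P u = P v)" using uv lab[of u] lab[of v] lab1[of u] lab1[of v] by (cases "u \<in> W1"; cases "v \<in> W1") auto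
  qed
  moreover have "pair_cost e W1 P = pair_cost e W1 D1" by (rule pair_cost_cong) (simp add: P_def)
  moreover have "\<epsilon>' * pair_cost e W1 P \<le> \<epsilon>' * pair_cost e W P"
    using pair_cost_mono[OF W1 fW] \<epsilon>(1) by (simp add: mult_left_mono)
  ultimately have "pair_cost e W Q2 \<le> (1 + \<epsilon>') * pair_cost e W P"
    using Q2_cost by (simp add: algebra_simps)
  also have "\<dots> \<le> (1 + \<epsilon>') * ((1 + \<epsilon>') * pair_cost e W D)"
    using near \<epsilon>(1) by (simp add: mult_left_mono)
  also have "\<dots> = ((1 + \<epsilon>') * (1 + \<epsilon>')) * pair_cost e W D" by simp
  also have "\<dots> \<le> (1 + \<epsilon>) * pair_cost e W D"
    using \<epsilon>(3) by (intro mult_right_mono pair_cost_nonneg)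
  finally have "pair_cost e W Q2 \<le> (1 + \<epsilon>) * pair_cost e W D" .
  moreover have "reach k m (k + m + 2) e n (Suc z) Q Q2"
    using reach_Suc[OF g] Q2(1) by (simp add: Q1_def)
  moreover have "Q2 u = Q u" if "u \<notin> W" for u
    using that Q2(2)[of u] g_out[OF that] W1 by (auto simp: Q1_def)
  moreover have "Q2 u \<in> A" if "u \<in> W" for u
    using that Q2(2,3)[of u] Q1L[of u] L(1) by (cases "u \<in> W1") auto
  ultimately show ?thesis by blast
qed

lemma approximable_exists:
  "0 < \<epsilon> \<Longrightarrow> \<epsilon> \<le> 1 \<Longrightarrow> \<exists>m0 z. \<forall>m\<ge>m0. approximable k r \<epsilon> m z"
proof (induction r arbitrary: \<epsilon>)
  case 0
  have "approximable k 0 \<epsilon> m 0" for m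
    unfolding approximable_def
  proof (intro allI impI)
    fix n :: nat and e :: "nat \<Rightarrow> nat \<Rightarrow> bool" and Q A D W
    assume "A \<subseteq> {..<k}" "card A \<le> 0" "W = {u. u < n \<and> Q u = k}" and D: "\<forall>u\<in>W. D u \<in> A"
    then have "A = {}" using finite_subset[of A "{..<k}"] by auto
    then have "W = {}" using D by blast
    then show "\<exists>Q'. reach k m (k + m + 2) e n 0 Q Q' \<and> (\<forall>u. u \<notin> W \<longrightarrow> Q' u = Q u) \<and> (\<forall>u\<in>W. Q' u \<in> A)
       \<and> pair_cost e W Q' \<le> (1 + \<epsilon>) * pair_cost e W D"
      by (intro exI[of _ Q]) (simp add: reach_0 pair_cost_def)
  qed
  then show ?case by blast
next
  case (Suc r)
  \<comment> \<open>Two factors \<open>1 + \<epsilon>'\<close> must stay within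
    \<open>1 + \<epsilon>\<close>, which a third achieves for \<epsilon> at most 1.\<close>
  define \<epsilon>' where "\<epsilon>' = \<epsilon> / 3"
  have \<epsilon>': "0 < \<epsilon>'" "\<epsilon>' \<le> 1" using Suc.prems by (simp_all add: \<epsilon>'_def)
  have "\<epsilon> * \<epsilon> \<le> \<epsilon> * 1" using Suc.prems by (intro mult_left_mono) auto
  have \<epsilon>: "(1 + \<epsilon>') * (1 + \<epsilon>') \<le> 1 + \<epsilon>"
  proof -
    have "(1 + \<epsilon>') * (1 + \<epsilon>') = 1 + 2 / 3 * \<epsilon> + \<epsilon> * \<epsilon> / 9" by (simp add: \<epsilon>'_def field_simps)
    then show ?thesis using \<open>\<epsilon> * \<epsilon> \<le> \<epsilon> * 1\<close> Suc.prems(1) by linarith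
  qed
  define \<gamma> where "\<gamma> = \<epsilon>' * ((\<epsilon>' / 32) ^ k / (real k + 1))\<^sup>2 / 64"
  have \<gamma>: "\<gamma> > 0" using \<epsilon>' by (simp add: \<gamma>_def)
  obtain m1 z1 where IH: "\<And>m. m \<ge> m1 \<Longrightarrow> approximable k r \<epsilon>' m z1"
    using Suc.IH[OF \<epsilon>'] by blast
  have "\<epsilon> * \<gamma> > 0" using \<gamma> Suc.prems by simp
  from reach_additive[OF this, of k] obtain m2 z2 where additive: "\<forall>m\<ge>m2. \<forall>n e Q A D W. similarity e \<longrightarrow> A \<subseteq> {..<k} \<longrightarrow> W = {u. u < n \<and> Q u = k} \<longrightarrow>
    (\<forall>u\<in>W. D u \<in> A) \<longrightarrow>
    (\<exists>Q'. reach k m (k + m + 2) e n z2 Q Q' \<and> (\<forall>u. u \<notin> W \<longrightarrow> Q' u = Q u) \<and> (\<forall>u\<in>W. Q' u \<in> A)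
      \<and> pair_cost e W Q' \<le> pair_cost e W D + \<epsilon> * \<gamma> * (card W)\<^sup>2)" by blast
  \<comment> \<open>Only one of the two methods is applied to an instance; the shorter one is padded
    with idle stages.\<close>
  define z where "z = max (Suc z1) z2"
  have "approximable k (Suc r) \<epsilon> m z" if m: "m \<ge> max m1 m2" for m
    unfolding approximable_def
  proof (intro allI impI)
    fix n :: nat and e :: "nat \<Rightarrow> nat \<Rightarrow> bool" and Q A D W
    assume e: "similarity e" and A: "A \<subseteq> {..<k}" "card A \<le> Suc r"
      and W: "W = {u. u < n \<and> Q u = k}" and D: "\<forall>u\<in>W. D u \<in> A"
    have "\<exists>z'\<le>z. \<exists>Q'. reach k m (k + m + 2) e n z' Q Q' \<and> (\<forall>u. u \<notin> W \<longrightarrow> Q' u = Q u) \<and> (\<forall>u\<in>W. Q' u \<in> A)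
       \<and> pair_cost e W Q' \<le> (1 + \<epsilon>) * pair_cost e W D"
    \<comment> \<open>The empty set joins the additive case, whose error term vanishes there; the
      centers need a vertex.\<close>
    proof (cases "W = {} \<or> \<gamma> * (card W)\<^sup>2 \<le> pair_cost e W D")
      case True
      have "m \<ge> m2" using m by simp
      from additive[THEN spec, THEN mp, OF this, THEN spec[where x = n], THEN spec[where x = e],
        THEN spec[where x = Q], THEN spec[where x = A], THEN spec[where x = D], THEN spec[where x = W],
        THEN mp, OF e, THEN mp, OF A(1), THEN mp, OF W, THEN mp, OF D]
      obtain Q' where Q': "reach k m (k + m + 2) e n z2 Q Q'" "\<forall>u. u \<notin> W \<longrightarrow> Q' u = Q u" "\<forall>u\<in>W. Q' u \<in> A"
        and cost: "pair_cost e W Q' \<le> pair_cost e W D + \<epsilon> * \<gamma> * (card W)\<^sup>2" by blast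
      have "\<gamma> * (card W)\<^sup>2 \<le> pair_cost e W D" using True by (auto simp: pair_cost_nonneg)
      then have "\<epsilon> * (\<gamma> * (card W)\<^sup>2) \<le> \<epsilon> * pair_cost e W D" using Suc.prems by (intro mult_left_mono) auto
      then have "pair_cost e W Q' \<le> (1 + \<epsilon>) * pair_cost e W D"
        using cost by (simp add: algebra_simps)
      then show ?thesis using Q' by (intro exI[of _ z2]) (auto simp: z_def)
    next
      case False
      then have W': "W \<noteq> {}" "pair_cost e W D \<le> \<gamma> * (card W)\<^sup>2" by auto
      have "approximable k r \<epsilon>' m z1" using IH m by simp
      from approximable_step[OF this \<epsilon>' \<epsilon> e A W W'(1) D W'(2)[unfolded \<gamma>_def]]
      show ?thesis by (intro exI[of _ "Suc z1"]) (simp add: z_def)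
    qed
    then obtain z' Q' where "z' \<le> z" and Q': "reach k m (k + m + 2) e n z' Q Q'"
      "(\<forall>u. u \<notin> W \<longrightarrow> Q' u = Q u) \<and> (\<forall>u\<in>W. Q' u \<in> A) \<and> pair_cost e W Q' \<le> (1 + \<epsilon>) * pair_cost e W D"
      by blast
    have "reach k m (k + m + 2) e n z Q Q'" using reach_mono[OF Q'(1) \<open>z' \<le> z\<close>] by simp
    then show "\<exists>Q'. reach k m (k + m + 2) e n z Q Q' \<and> (\<forall>u. u \<notin> W \<longrightarrow> Q' u = Q u) \<and> (\<forall>u\<in>W. Q' u \<in> A)
       \<and> pair_cost e W Q' \<le> (1 + \<epsilon>) * pair_cost e W D"
      using Q'(2) by blast
  qed
  then show ?case by blast
qed

section \<open>The program\<close>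

text \<open>The two truncated differences add up to the distance of the values; subtracting it from
  1 yields the equality bit.\<close>

abbreviation NE :: "expr \<Rightarrow> expr \<Rightarrow> expr" where
  "NE a b \<equiv> Sub (Num 1) (Sub (Num 1) (Add (Sub a b) (Sub b a)))"

abbreviation EQ :: "expr \<Rightarrow> expr \<Rightarrow> expr" where
  "EQ a b \<equiv> Sub (Num 1) (Add (Sub a b) (Sub b a))"

lemma val_EQ: "val (EQ a b) s = of_bool (val a s = val b s)"
  by auto

lemma val_NE: "val (NE a b) s = of_bool (val a s \<noteq> val b s)"
  by auto

primrec sum_expr :: "(nat \<Rightarrow> expr) \<Rightarrow> nat \<Rightarrow> expr" where
  "sum_expr f 0 = Num 0"
| "sum_expr f (Suc m) = Add (sum_expr f m) (f m)"

lemma val_sum_expr: "val (sum_expr f m) s = (\<Sum>j<m. val (f j) s)"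
  by (induction m) simp_all

text \<open>The number of labels is a constant, so loops over labels are unrolled into the program
  text. The last index is included, for the label \<open>k\<close>.\<close>

primrec seq_upto :: "(nat \<Rightarrow> lcom) \<Rightarrow> nat \<Rightarrow> lcom" where
  "seq_upto f 0 = f 0"
| "seq_upto f (Suc k) = LSeq (seq_upto f k) (f (Suc k))"

lemma asg_seq_upto: "asg (seq_upto f k) = (\<Union>i\<le>k. asg (f i))"
  by (induction k) (auto simp: le_Suc_eq)

lemma wf_seq_upto: "wf_loops (seq_upto f k) \<longleftrightarrow> (\<forall>i\<le>k. wf_loops (f i))"
  by (induction k) (auto simp: le_Suc_eq)

text \<open>The premise says that expression \<open>i\<close> reads no entry of \<open>x\<close>
  below \<open>i\<close>, that is, none already overwritten; the sequence then acts as a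
  simultaneous assignment.\<close>

lemma sem_seq_upto_assign:
  assumes "\<And>i h. i \<le> k \<Longrightarrow> (\<forall>j\<ge>i. h j = s x j) \<Longrightarrow> val (f i) (s(x := h)) = val (f i) s"
  shows "sem (seq_upto (\<lambda>i. LAssign x (Num i) (f i)) k) s
    = s(x := (\<lambda>i. if i \<le> k then val (f i) s else s x i))"
  using assms
proof (induction k)
  case 0
  then show ?case by (auto simp: put_def fun_eq_iff)
next
  case (Suc k)
  let ?h = "\<lambda>i. if i \<le> k then val (f i) s else s x i"
  have "val (f (Suc k)) (s(x := ?h)) = val (f (Suc k)) s"
    by (rule Suc.prems) auto
  moreover have "sem (seq_upto (\<lambda>i. LAssign x (Num i) (f i)) k) s = s(x := ?h)"
    by (rule Suc.IH) (use Suc.prems in auto)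
  ultimately have "sem (seq_upto (\<lambda>i. LAssign x (Num i) (f i)) (Suc k)) s
      = put (s(x := ?h)) x (Suc k) (val (f (Suc k)) s)" by simp
  also have "\<dots> = s(x := (\<lambda>i. if i \<le> Suc k then val (f i) s else s x i))"
    by (auto simp: put_def fun_eq_iff le_Suc_eq)
  finally show ?case .
qed

text \<open>Loop counters are scalars with names fixed in the text. Unary words over one letter give
  arbitrarily many distinct names, apart from the other variables by their first letter.\<close>

definition guess_var :: "nat \<Rightarrow> string" where
  "guess_var i = replicate (Suc i) CHR ''g''"

lemma guess_inj [simp]: "guess_var i = guess_var j \<longleftrightarrow> i = j"
  by (auto simp: guess_var_def)

lemma guess_neq [simp]: "c \<noteq> CHR ''g'' \<Longrightarrow> guess_var i \<noteq> c # cs" "c \<noteq> CHR ''g'' \<Longrightarrow> c # cs \<noteq> guess_var i"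
  by (auto simp: guess_var_def)

abbreviation at_var :: "string \<Rightarrow> string \<Rightarrow> expr" where
  "at_var a x \<equiv> Cell a (scalar x)"

abbreviation edge :: "expr \<Rightarrow> expr \<Rightarrow> expr" where
  "edge a b \<equiv> Cell ''label'' (Add (Cell ''row'' a) b)"

primrec largmin :: "nat \<Rightarrow> lcom" where
  "largmin 0 = LAssign ''bi'' (Num 0) (Num 0)"
| "largmin (Suc k) = LSeq (largmin k)
     (LCond (Sub (at_var ''sc'' ''bi'') (Cell ''sc'' (Num (Suc k))))
       (LAssign ''bi'' (Num 0) (Num (Suc k))) LSkip)"

lemma asg_largmin: "asg (largmin k) = {''bi''}"
  by (induction k) auto

lemma wf_largmin: "wf_loops (largmin k)"
  by (induction k) auto

lemma sem_largmin: "sem (largmin k) s ''bi'' 0 = argmin_upto k (s ''sc'')"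
proof (induction k)
  case (Suc k)
  have "sem (largmin k) s ''sc'' = s ''sc''" by (rule sem_frame) (simp add: asg_largmin)
  then show ?case using Suc by (simp add: put_def)
qed (simp add: put_def)

section \<open>Programs for a single stage\<close>

definition score_base :: "nat \<Rightarrow> nat \<Rightarrow> nat \<Rightarrow> expr" where
  "score_base m b i = Add (scalar (guess_var (b + 7 * i)))
     (sum_expr (\<lambda>j. NE (edge (scalar ''u'') (scalar (guess_var (b + (7 * j + 2)))))
        (EQ (scalar (guess_var (b + (7 * j + 3)))) (Num i))) m)"

text \<open>For bits, truncated subtraction is "and not"; it replaces the product with the flag
  \<open>g 6\<close>, which is why valid guesses restrict that entry to a bit.\<close>

definition score_incr :: "nat \<Rightarrow> nat \<Rightarrow> nat \<Rightarrow> expr" where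
  "score_incr k b i = Add (Cell ''sc'' (Num i)) (Sub (at_var ''act'' ''x'')
     (EQ (edge (scalar ''u'') (scalar ''x''))
       (if i < k then edge (scalar (guess_var (b + (7 * i + 1)))) (scalar ''x'') else Num 0)))"

definition lscore :: "nat \<Rightarrow> nat \<Rightarrow> nat \<Rightarrow> lcom" where
  "lscore k m b = LSeq (seq_upto (\<lambda>i. LAssign ''sc'' (Num i) (score_base m b i)) k)
     (LFor ''x'' 0 (seq_upto (\<lambda>i. LAssign ''sc'' (Num i) (score_incr k b i)) k))"

definition lplace :: "nat \<Rightarrow> nat \<Rightarrow> nat \<Rightarrow> lcom" where
  "lplace k m b = LCond (NE (at_var ''cl'' ''u'') (Num k)) LSkip
     (LCond (Sub (scalar (guess_var (b + 4))) (scalar ''u''))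
       (LSeq (lscore k m b) (LSeq (largmin k) (LAssign ''cl'' (scalar ''u'') (scalar ''bi'')))) LSkip)"

text \<open>\<open>act\<close> freezes the set of pending vertices before any of them is placed: the
  scores refer to the labelling at the start of the stage, but \<open>cl\<close> is updated in
  place.\<close>

definition lstage :: "nat \<Rightarrow> nat \<Rightarrow> nat \<Rightarrow> lcom" where
  "lstage k m b = LSeq
     (LFor ''x'' 0 (LAssign ''act'' (scalar ''x'')
       (Sub (scalar (guess_var (b + 6))) (NE (at_var ''cl'' ''x'') (Num k)))))
     (LFor ''u'' 0 (lplace k m b))"

lemma asg_lscore: "asg (lscore k m b) = {''sc'', ''x''}"
  by (auto simp: lscore_def asg_seq_upto)

lemma asg_lplace: "asg (lplace k m b) = {''sc'', ''x'', ''bi'', ''cl''}"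
  by (auto simp: lplace_def asg_lscore asg_largmin)

lemma asg_lstage: "asg (lstage k m b) = {''sc'', ''x'', ''bi'', ''cl'', ''act'', ''u''}"
  by (auto simp: lstage_def asg_lplace)

lemma wf_lstage: "wf_loops (lstage k m b)"
  by (simp add: lstage_def lplace_def lscore_def asg_lscore asg_largmin asg_seq_upto wf_seq_upto wf_largmin)

text \<open>\<open>row\<close> tabulates the row offsets because the machine cannot
  multiply.\<close>

definition prepared :: "nat \<Rightarrow> (nat \<Rightarrow> nat \<Rightarrow> bool) \<Rightarrow> store \<Rightarrow> bool" where
  "prepared n e s \<longleftrightarrow> s ''n'' 0 = n \<and> (\<forall>u<n. s ''row'' u = u * n) \<and>
     (\<forall>u<n. \<forall>v<n. s ''label'' (u * n + v) = of_bool (e u v))"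

lemma prepared_cong:
  "s' ''n'' = s ''n'' \<Longrightarrow> s' ''row'' = s ''row'' \<Longrightarrow> s' ''label'' = s ''label'' \<Longrightarrow>
    prepared n e s' = prepared n e s"
  by (simp add: prepared_def)

lemma val_edge:
  assumes "prepared n e s" "val a s < n" "val b s < n"
  shows "val (edge a b) s = of_bool (e (val a s) (val b s))"
  using assms by (simp add: prepared_def)

lemma sem_lscore:
  assumes p: "prepared n e s" and u: "s ''u'' 0 < n"
    and g: "g = (\<lambda>i. s (guess_var (b + i)) 0)" "valid_guess n K g"
    and act: "\<And>x. x < n \<Longrightarrow> s ''act'' x = g 6 * of_bool (Q x = k)"
    and i: "i \<le> k"
  shows "sem (lscore k m b) s ''sc'' i = score k m e n g Q (s ''u'' 0) i"
proof -
  define u where "u = s ''u'' 0"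
  have gn: "g (7 * i + 1) < n" "g (7 * i + 2) < n" for i
    using g(2) u by (auto simp: valid_guess_def)
  have fl: "g 6 \<le> 1" using g(2) by (simp add: valid_guess_def)
  define base where "base i = g (7 * i) + (\<Sum>j<m. of_bool (e u (g (7 * j + 2)) \<noteq> (g (7 * j + 3) = i)))" for i
  define s1 where "s1 = sem (seq_upto (\<lambda>i. LAssign ''sc'' (Num i) (score_base m b i)) k) s"
  have s1: "s1 = s(''sc'' := (\<lambda>i. if i \<le> k then val (score_base m b i) s else s ''sc'' i))"
    unfolding s1_def
    by (rule sem_seq_upto_assign) (simp add: score_base_def val_sum_expr)
  have base: "val (score_base m b i) s = base i" for i
  proof -
    have "val (NE (edge (scalar ''u'') (scalar (guess_var (b + (7 * j + 2)))))
        (EQ (scalar (guess_var (b + (7 * j + 3)))) (Num i))) s = of_bool (e u (g (7 * j + 2)) \<noteq> (g (7 * j + 3) = i))" for j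
      unfolding val_NE val_EQ by (subst val_edge[OF p]) (use gn(2)[of j] assms(2) in \<open>auto simp: g(1) u_def\<close>)
    then show ?thesis unfolding score_base_def by (simp only: val.simps val_sum_expr) (simp add: base_def g(1))
  qed
  let ?I = "\<lambda>y s'. \<forall>i\<le>k. s' ''sc'' i = base i + g 6 * (\<Sum>x<y. of_bool (Q x = k \<and> e u x \<noteq> (i < k \<and> e (g (7 * i + 1)) x)))"
  have "?I n (sem (LFor ''x'' 0 (seq_upto (\<lambda>i. LAssign ''sc'' (Num i) (score_incr k b i)) k)) s1)"
  proof (rule sem_LFor_inv[where I = ?I and N = n])
    show "s1 ''n'' 0 + 0 = n" using p by (simp add: s1 prepared_def)
    show "?I 0 (put s1 ''x'' 0 0)" by (simp add: put_def s1 base)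
    fix y s'
    assume y: "y < n" and frame: "\<And>z. z \<noteq> ''x'' \<Longrightarrow> z \<notin> asg (seq_upto (\<lambda>i. LAssign ''sc'' (Num i) (score_incr k b i)) k) \<Longrightarrow> s' z = s1 z"
      and x: "s' ''x'' 0 = y" and IH: "?I y s'"
    have same: "s' z = s z" if "z \<noteq> ''x''" "z \<noteq> ''sc''" for z
      using frame[of z] that by (simp add: asg_seq_upto s1)
    have p': "prepared n e s'" using p by (subst prepared_cong[of s' s]) (simp_all add: same)
    have step: "sem (seq_upto (\<lambda>i. LAssign ''sc'' (Num i) (score_incr k b i)) k) s'
        = s'(''sc'' := (\<lambda>i. if i \<le> k then val (score_incr k b i) s' else s' ''sc'' i))"
      by (rule sem_seq_upto_assign) (auto simp: score_incr_def)
    have incr: "val (score_incr k b i) s' = s' ''sc'' i + g 6 * of_bool (Q y = k \<and> e u y \<noteq> (i < k \<and> e (g (7 * i + 1)) y))" for i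
    proof -
      have 1: "val (edge (scalar ''u'') (scalar ''x'')) s' = of_bool (e u y)"
        by (subst val_edge[OF p']) (use assms(2) y in \<open>simp_all add: same x u_def\<close>)
      have 2: "val (edge (scalar (guess_var (b + (7 * i + 1)))) (scalar ''x'')) s' = of_bool (e (g (7 * i + 1)) y)"
        by (subst val_edge[OF p']) (use gn(1)[of i] y in \<open>simp_all add: same x g(1)\<close>)
      have 3: "val (if i < k then edge (scalar (guess_var (b + (7 * i + 1)))) (scalar ''x'') else Num 0) s'
          = of_bool (i < k \<and> e (g (7 * i + 1)) y)"
        using 2 by (cases "i < k") (simp_all only: if_True if_False simp_thms val.simps of_bool_eq)
      have 4: "val (at_var ''act'' ''x'') s' = g 6 * of_bool (Q y = k)"
        using act[OF y] by (simp add: same x)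
      have "val (score_incr k b i) s' = s' ''sc'' i + (g 6 * of_bool (Q y = k)
          - of_bool (of_bool (e u y) = (of_bool (i < k \<and> e (g (7 * i + 1)) y) :: nat)))"
        unfolding score_incr_def val.simps(3) val.simps(4)[of "at_var ''act'' ''x''"] val_EQ 1 3 4 by simp
      then show ?thesis using fl by (auto simp: of_bool_def)
    qed
    show "?I (Suc y) (bump ''x'' (sem (seq_upto (\<lambda>i. LAssign ''sc'' (Num i) (score_incr k b i)) k) s'))"
    proof (intro allI impI)
      fix i assume i: "i \<le> k"
      then have "bump ''x'' (sem (seq_upto (\<lambda>i. LAssign ''sc'' (Num i) (score_incr k b i)) k) s') ''sc'' i
          = val (score_incr k b i) s'"
        by (simp add: step bump_def put_def)
      also have "\<dots> = base i + g 6 * (\<Sum>x<Suc y. of_bool (Q x = k \<and> e u x \<noteq> (i < k \<and> e (g (7 * i + 1)) x)))"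
        by (simp only: incr IH[rule_format, OF i] sum.lessThan_Suc distrib_left add.assoc)
      finally show "bump ''x'' (sem (seq_upto (\<lambda>i. LAssign ''sc'' (Num i) (score_incr k b i)) k) s') ''sc'' i
        = base i + g 6 * (\<Sum>x<Suc y. of_bool (Q x = k \<and> e u x \<noteq> (i < k \<and> e (g (7 * i + 1)) x)))" .
    qed
  qed (auto simp: asg_seq_upto)
  then show ?thesis using i by (simp add: lscore_def s1_def[symmetric] score_def base_def u_def)
qed

lemma sem_lstage:
  assumes p: "prepared n e s"
    and g: "g = (\<lambda>i. s (guess_var (b + i)) 0)" "valid_guess n K g"
    and Q: "\<And>v. v < n \<Longrightarrow> s ''cl'' v = Q v" and v: "v < n"
  shows "sem (lstage k m b) s ''cl'' v = stage k m e n g Q v"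
proof -
  have n: "s ''n'' 0 = n" using p by (simp add: prepared_def)
  have fl: "g 6 \<le> 1" using g(2) by (simp add: valid_guess_def)
  define c1 where "c1 = LAssign ''act'' (scalar ''x'')
       (Sub (scalar (guess_var (b + 6))) (NE (at_var ''cl'' ''x'') (Num k)))"
  define s1 where "s1 = sem (LFor ''x'' 0 c1) s"
  have same1: "s1 z = s z" if "z \<noteq> ''x''" "z \<noteq> ''act''" for z
    unfolding s1_def by (rule sem_frame) (use that in \<open>simp add: c1_def\<close>)
  have "\<forall>x<n. s1 ''act'' x = g 6 * of_bool (Q x = k)"
    unfolding s1_def
  proof (rule sem_LFor_inv[where I = "\<lambda>y s'. \<forall>x<y. s' ''act'' x = g 6 * of_bool (Q x = k)" and N = n])
    fix y s'
    assume y: "y < n" and frame: "\<And>z. z \<noteq> ''x'' \<Longrightarrow> z \<notin> asg c1 \<Longrightarrow> s' z = s z"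
      and x: "s' ''x'' 0 = y" and IH: "\<forall>x<y. s' ''act'' x = g 6 * of_bool (Q x = k)"
    have "s' ''cl'' = s ''cl''" "s' (guess_var (b + 6)) = s (guess_var (b + 6))"
      by (rule frame; simp add: c1_def)+
    then have "sem c1 s' = put s' ''act'' y (g 6 * of_bool (Q y = k))"
      using Q[OF y] fl by (simp add: c1_def x g(1) val_NE del: val.simps(4)) (auto simp: of_bool_def x)
    then show "\<forall>x<Suc y. bump ''x'' (sem c1 s') ''act'' x = g 6 * of_bool (Q x = k)"
      using IH by (simp add: bump_def put_def less_Suc_eq)
  qed (auto simp: c1_def n)
  then have act: "s1 ''act'' x = g 6 * of_bool (Q x = k)" if "x < n" for x using that by simp
  \<comment> \<open>Updating in place is harmless: vertex \<open>y\<close> still has its old label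
    when its turn comes, and the other labels enter its score only through
    \<open>act\<close>.\<close>
  let ?I = "\<lambda>y s'. \<forall>v<n. s' ''cl'' v = (if v < y then stage k m e n g Q v else Q v)"
  have "?I n (sem (LFor ''u'' 0 (lplace k m b)) s1)"
  proof (rule sem_LFor_inv[where I = ?I and N = n])
    show "s1 ''n'' 0 + 0 = n" by (simp add: same1 n)
    show "?I 0 (put s1 ''u'' 0 0)" using Q by (simp add: put_def same1)
    fix y s'
    assume y: "y < n" and frame: "\<And>z. z \<noteq> ''u'' \<Longrightarrow> z \<notin> asg (lplace k m b) \<Longrightarrow> s' z = s1 z"
      and u: "s' ''u'' 0 = y" and IH: "?I y s'"
    have same: "s' z = s z" if "z \<notin> {''u'', ''sc'', ''x'', ''bi'', ''cl'', ''act''}" for z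
      using frame[of z] same1[of z] that by (simp add: asg_lplace)
    have act': "s' ''act'' = s1 ''act''" by (rule frame) (simp_all add: asg_lplace)
    have p': "prepared n e s'" using p by (subst prepared_cong[of s' s]) (simp_all add: same)
    have g': "g = (\<lambda>i. s' (guess_var (b + i)) 0)" by (simp add: g(1) same)
    have cl: "s' ''cl'' y = Q y" using IH y by simp
    define s2 where "s2 = sem (lscore k m b) s'"
    have "s2 ''sc'' i = score k m e n g Q y i" if "i \<le> k" for i
      unfolding s2_def using sem_lscore[OF p' _ g' g(2) _ that, of Q m] y act act' u by simp
    then have am: "argmin_upto k (s2 ''sc'') = argmin_upto k (score k m e n g Q y)"
      by (rule argmin_upto_cong)
    have s2_cl: "sem (largmin k) s2 ''cl'' = s' ''cl''" "sem (largmin k) s2 ''u'' 0 = y"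
      using u by (simp_all add: sem_frame asg_largmin s2_def asg_lscore)
    have "sem (lplace k m b) s' ''cl'' = (s' ''cl'')(y := stage k m e n g Q y)"
      using cl y by (auto simp: lplace_def u stage_def s2_def[symmetric] s2_cl put_def sem_largmin am g')
    then show "?I (Suc y) (bump ''u'' (sem (lplace k m b) s'))"
      using IH by (auto simp: bump_def put_def less_Suc_eq)
  qed (auto simp: asg_lplace)
  then show ?thesis using v unfolding lstage_def c1_def[symmetric] by (simp only: sem.simps(3) s1_def[symmetric] if_True)
qed

section \<open>Sequences of stages and the vector of all guesses\<close>

primrec stages :: "nat \<Rightarrow> nat \<Rightarrow> (nat \<Rightarrow> nat \<Rightarrow> bool) \<Rightarrow> nat \<Rightarrow> (nat \<Rightarrow> nat \<Rightarrow> nat) \<Rightarrow> nat \<Rightarrow> (nat \<Rightarrow> nat) \<Rightarrow> nat \<Rightarrow> nat" where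
  "stages k m e n gs 0 Q = Q"
| "stages k m e n gs (Suc z) Q = stage k m e n (gs z) (stages k m e n gs z Q)"

text \<open>\<open>stages\<close> is unfolded at the last stage, whereas \<open>reach\<close> is
  built from the first.\<close>

lemma stages_shift:
  "stages k m e n gs (Suc z) Q = stages k m e n (\<lambda>t. gs (Suc t)) z (stage k m e n (gs 0) Q)"
  by (induction z) simp_all

lemma reach_stages:
  "reach k m K e n z Q Q' \<Longrightarrow> \<exists>gs. (\<forall>t<z. valid_guess n K (gs t)) \<and> Q' = stages k m e n gs z Q"
proof (induction rule: reach.induct)
  case (reach_0 Q)
  then show ?case by simp
next
  case (reach_Suc g z Q Q')
  then obtain gs where gs: "\<forall>t<z. valid_guess n K (gs t)" "Q' = stages k m e n gs z (stage k m e n g Q)"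
    by blast
  have "Q' = stages k m e n (case_nat g gs) (Suc z) Q"
    unfolding stages_shift using gs(2) by simp
  moreover have "\<forall>t<Suc z. valid_guess n K (case_nat g gs t)"
    using gs(1) reach_Suc.hyps(1) by (auto split: nat.split)
  ultimately show ?case by blast
qed

text \<open>Exceeds every position that a stage reads, and is a multiple of 7 so that consecutive
  blocks keep the residues of the layout.\<close>

definition block :: "nat \<Rightarrow> nat \<Rightarrow> nat" where
  "block k m = 7 * (k + m + 1)"

lemma stage_guess_cong:
  assumes "\<And>i. i < block k m \<Longrightarrow> g i = g' i"
  shows "stage k m e n g = stage k m e n g'"
proof -
  have "score k m e n g Q u i = score k m e n g' Q u i" if "i \<le> k" for Q u i
  proof -
    have "g (7 * i) = g' (7 * i)" "g 6 = g' 6" by (rule assms; use that in \<open>simp add: block_def\<close>)+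
    moreover have "g (7 * j + 2) = g' (7 * j + 2)" "g (7 * j + 3) = g' (7 * j + 3)" if "j < m" for j
      by (rule assms; use that in \<open>simp add: block_def\<close>)+
    moreover have "g (7 * i + 1) = g' (7 * i + 1)" by (rule assms) (use that in \<open>simp add: block_def\<close>)
    ultimately show ?thesis by (simp add: score_def cong: sum.cong_simp)
  qed
  moreover have "g 4 = g' 4" by (rule assms) (simp add: block_def)
  ultimately show ?thesis
    by (intro ext) (auto simp: stage_def intro!: argmin_upto_cong)
qed

primrec lstages :: "nat \<Rightarrow> nat \<Rightarrow> nat \<Rightarrow> lcom" where
  "lstages k m 0 = LSkip"
| "lstages k m (Suc z) = LSeq (lstages k m z) (lstage k m (z * block k m))"

lemma asg_lstages: "asg (lstages k m z) \<subseteq> {''sc'', ''x'', ''bi'', ''cl'', ''act'', ''u''}"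
  by (induction z) (auto simp: asg_lstage)

lemma wf_lstages: "wf_loops (lstages k m z)"
  by (induction z) (auto simp: wf_lstage)

lemma sem_lstages_frame:
  "y \<notin> {''sc'', ''x'', ''bi'', ''cl'', ''act'', ''u''} \<Longrightarrow> sem (lstages k m z) s y = s y"
  using asg_lstages[of k m z] by (intro sem_frame) blast

text \<open>Stated by residues, the range conditions are invariant under shifts by whole
  blocks.\<close>

lemma valid_guess_mod:
  "valid_guess n K g \<longleftrightarrow> g 6 \<le> 1 \<and> (\<forall>x. g x < n + K \<and> (x mod 7 = 1 \<or> x mod 7 = 2 \<longrightarrow> n = 0 \<or> g x < n))"
proof -
  have "(\<forall>i. g (7 * i + r) < n) \<longleftrightarrow> (\<forall>x. x mod 7 = r \<longrightarrow> g x < n)" if "r < 7" for r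
  proof safe
    fix x assume "\<forall>i. g (7 * i + x mod 7) < n" "r = x mod 7"
    then have "g (7 * (x div 7) + x mod 7) < n" by blast
    then show "g x < n" by simp
  next
    fix i assume *: "\<forall>x. x mod 7 = r \<longrightarrow> g x < n"
    have "(7 * i + r) mod 7 = r" using that by simp
    then show "g (7 * i + r) < n" using * by blast
  qed
  from this[of 1] this[of 2] have
    "(\<forall>i. g (7 * i + 1) < n) \<longleftrightarrow> (\<forall>x. x mod 7 = 1 \<longrightarrow> g x < n)"
    "(\<forall>i. g (7 * i + 2) < n) \<longleftrightarrow> (\<forall>x. x mod 7 = 2 \<longrightarrow> g x < n)" by simp_all
  then show ?thesis unfolding valid_guess_def by (cases "n = 0") blast+
qed

text \<open>Concatenates the blocks read by the stages into one vector of constant length, which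
  nested loops can enumerate. Beyond its own block a shifted vector runs into the next ones; it
  stays valid by residues, and the stage does not look there.\<close>

lemma guess_vector_exists:
  assumes "\<And>t. t < z \<Longrightarrow> valid_guess n K (gs t)" "K \<ge> 1"
  shows "\<exists>G. (\<forall>x. G x < n + K) \<and> (\<forall>x\<ge>z * block k m. G x = 0) \<and>
    (\<forall>t<z. valid_guess n K (\<lambda>i. G (t * block k m + i))) \<and>
    (\<forall>Q. stages k m e n (\<lambda>t i. G (t * block k m + i)) z Q = stages k m e n gs z Q)"
proof -
  define B where "B = block k m"
  have B: "B > 6" "7 dvd B" by (simp_all add: B_def block_def)
  \<comment> \<open>The value 0 past the end is the content of guess variables that no loop
    sets.\<close>
  define G where "G x = (if x < z * B then gs (x div B) (x mod B) else 0)" for x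
  have div: "x div B < z" if "x < z * B" for x using that by (simp add: less_mult_imp_div_less)
  have valid: "valid_guess n K (gs (x div B))" if "x < z * B" for x using assms(1) div[OF that] by blast
  have G: "G x < n + K" "x mod 7 = 1 \<or> x mod 7 = 2 \<Longrightarrow> n = 0 \<or> G x < n" for x
  proof -
    show "G x < n + K" using valid[of x] assms(2) by (auto simp: G_def valid_guess_mod)
    have "x mod B mod 7 = x mod 7" using B(2) by (rule mod_mod_cancel)
    then show "n = 0 \<or> G x < n" if "x mod 7 = 1 \<or> x mod 7 = 2"
      using valid[of x] that by (auto simp: G_def valid_guess_mod)
  qed
  have blk: "G (t * B + i) = gs t i" if "t < z" "i < B" for t i
  proof -
    have "t * B + i < Suc t * B" using that by simp
    also have "\<dots> \<le> z * B" using that by (intro mult_right_mono) auto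
    finally show ?thesis using that by (simp add: G_def)
  qed
  have "valid_guess n K (\<lambda>i. G (t * B + i))" if "t < z" for t
    unfolding valid_guess_mod
  proof (intro conjI allI impI)
    show "G (t * B + 6) \<le> 1" using blk[OF that, of 6] assms(1)[OF that] B by (simp add: valid_guess_def)
    fix x
    show "G (t * B + x) < n + K" by (rule G)
    obtain B' where B': "B = 7 * B'" using B(2) by (rule dvdE)
    have "t * B + x = x + 7 * (t * B')" by (simp add: B')
    then have "(t * B + x) mod 7 = x mod 7" by (simp only: mod_mult_self2)
    then show "n = 0 \<or> G (t * B + x) < n" if "x mod 7 = 1 \<or> x mod 7 = 2" using G(2) that by simp
  qed
  moreover have "stages k m e n (\<lambda>t i. G (t * B + i)) z' Q = stages k m e n gs z' Q" if "z' \<le> z" for z' Q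
    using that
  proof (induction z')
    case (Suc z')
    have "stage k m e n (\<lambda>i. G (z' * B + i)) = stage k m e n (gs z')"
      by (rule stage_guess_cong) (use blk[of z'] Suc.prems in \<open>simp add: B_def\<close>)
    then show ?case using Suc by simp
  qed simp
  ultimately show ?thesis using G(1) by (intro exI[of _ G]) (auto simp: B_def[symmetric] G_def)
qed

lemma sem_lstages:
  assumes p: "prepared n e s" and Q: "\<And>v. v < n \<Longrightarrow> s ''cl'' v = Q v"
    and gs: "\<And>t i. t < z \<Longrightarrow> s (guess_var (t * block k m + i)) 0 = gs t i" "\<And>t. t < z \<Longrightarrow> valid_guess n K (gs t)"
    and v: "v < n"
  shows "sem (lstages k m z) s ''cl'' v = stages k m e n gs z Q v"
  using gs v
proof (induction z arbitrary: v)
  case 0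
  then show ?case using Q by simp
next
  case (Suc z)
  let ?s = "sem (lstages k m z) s"
  have p': "prepared n e ?s" using p by (subst prepared_cong[of ?s s]) (simp_all add: sem_lstages_frame)
  have "gs z = (\<lambda>i. ?s (guess_var (z * block k m + i)) 0)"
    using Suc.prems(1)[of z] by (simp add: sem_lstages_frame)
  from sem_lstage[OF p' this Suc.prems(2), of "stages k m e n gs z Q"] Suc
  show ?case by simp
qed

section \<open>Evaluating one guess vector\<close>

definition pair_count :: "(nat \<Rightarrow> nat \<Rightarrow> bool) \<Rightarrow> nat \<Rightarrow> (nat \<Rightarrow> nat) \<Rightarrow> nat" where
  "pair_count e n P = (\<Sum>u<n. \<Sum>v<n. of_bool (e u v \<noteq> (P u = P v)))"

lemma pair_count_cost: "real (pair_count e n P) = pair_cost e {..<n} P"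
  unfolding pair_count_def pair_cost_def of_nat_sum of_nat_of_bool by simp

lemma pair_count_le: "pair_count e n P \<le> n * n"
proof -
  have "pair_count e n P \<le> (\<Sum>u<n. \<Sum>v<n. 1)" unfolding pair_count_def by (intro sum_mono) auto
  then show ?thesis by simp
qed

lemma pair_count_cong: "(\<And>u. u < n \<Longrightarrow> P u = P' u) \<Longrightarrow> pair_count e n P = pair_count e n P'"
  unfolding pair_count_def by (intro sum.cong refl) auto

definition lfill :: "nat \<Rightarrow> lcom" where
  "lfill k = LFor ''u'' 0 (LAssign ''cl'' (scalar ''u'') (Num k))"

text \<open>A bad guess may leave vertices pending; giving them label 0 makes every candidate a
  clustering with at most \<open>k\<close> parts.\<close>

definition lfinish :: "nat \<Rightarrow> lcom" where
  "lfinish k = LFor ''u'' 0 (LCond (Sub (Num k) (at_var ''cl'' ''u'')) LSkip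
     (LAssign ''cl'' (scalar ''u'') (Num 0)))"

definition lcount :: lcom where
  "lcount = LSeq (LAssign ''cost'' (Num 0) (Num 0))
     (LFor ''u'' 0 (LFor ''x'' 0 (LAssign ''cost'' (Num 0) (Add (scalar ''cost'')
        (NE (edge (scalar ''u'') (scalar ''x'')) (EQ (at_var ''cl'' ''u'') (at_var ''cl'' ''x'')))))))"

definition lcopy :: lcom where
  "lcopy = LFor ''u'' 0 (LAssign ''cluster'' (scalar ''u'') (at_var ''cl'' ''u''))"

definition lkeep :: lcom where
  "lkeep = LCond (Sub (scalar ''best'') (scalar ''cost''))
     (LSeq (LAssign ''best'' (Num 0) (scalar ''cost'')) lcopy) LSkip"

definition ltry :: "nat \<Rightarrow> nat \<Rightarrow> nat \<Rightarrow> lcom" where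
  "ltry k m z = LSeq (lfill k) (LSeq (lstages k m z) (LSeq (lfinish k) (LSeq lcount lkeep)))"

lemma asg_ltry: "asg (ltry k m z) \<subseteq> {''sc'', ''x'', ''bi'', ''cl'', ''act'', ''u'', ''cost'', ''best'', ''cluster''}"
proof -
  have "asg (lstages k m z) \<subseteq> {''sc'', ''x'', ''bi'', ''cl'', ''act'', ''u'', ''cost'', ''best'', ''cluster''}"
    by (rule subset_trans[OF asg_lstages]) simp
  then show ?thesis by (simp add: ltry_def lfill_def lfinish_def lcount_def lkeep_def lcopy_def)
qed

lemma wf_ltry: "wf_loops (ltry k m z)"
  by (simp add: ltry_def lfill_def lfinish_def lcount_def lkeep_def lcopy_def wf_lstages)

lemma sem_lfill:
  assumes "s ''n'' 0 = n" "v < n" shows "sem (lfill k) s ''cl'' v = k"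
proof -
  have "\<forall>v<n. sem (lfill k) s ''cl'' v = k"
    unfolding lfill_def
    by (rule sem_LFor_inv[where I = "\<lambda>i s'. \<forall>v<i. s' ''cl'' v = k"])
      (use assms(1) in \<open>auto simp: bump_def put_def less_Suc_eq\<close>)
  then show ?thesis using assms(2) by blast
qed

lemma sem_lfinish:
  assumes "s ''n'' 0 = n" "v < n"
  shows "sem (lfinish k) s ''cl'' v = (if s ''cl'' v < k then s ''cl'' v else 0)"
proof -
  define c where "c = LCond (Sub (Num k) (at_var ''cl'' ''u'')) LSkip (LAssign ''cl'' (scalar ''u'') (Num 0))"
  let ?I = "\<lambda>i s'. \<forall>v. s' ''cl'' v = (if v < i \<and> \<not> s ''cl'' v < k then 0 else s ''cl'' v)"
  have "?I n (sem (LFor ''u'' 0 c) s)"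
    by (rule sem_LFor_inv[where I = ?I])
      (use assms(1) in \<open>auto simp: c_def bump_def put_def less_Suc_eq\<close>)
  then show ?thesis using assms(2) by (simp add: lfinish_def c_def del: sem.simps)
qed

lemma sem_lcopy:
  assumes "s ''n'' 0 = n" "v < n" shows "sem lcopy s ''cluster'' v = s ''cl'' v"
proof -
  have "\<forall>v<n. sem lcopy s ''cluster'' v = s ''cl'' v"
    unfolding lcopy_def
    by (rule sem_LFor_inv[where I = "\<lambda>i s'. \<forall>v<i. s' ''cluster'' v = s ''cl'' v"])
      (use assms(1) in \<open>auto simp: bump_def put_def less_Suc_eq\<close>)
  then show ?thesis using assms(2) by blast
qed

lemma sem_lcount:
  assumes p: "prepared n e s"
  shows "sem lcount s ''cost'' 0 = pair_count e n (s ''cl'')"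
proof -
  define P where "P = s ''cl''"
  define c where "c = LAssign ''cost'' (Num 0) (Add (scalar ''cost'')
        (NE (edge (scalar ''u'') (scalar ''x'')) (EQ (at_var ''cl'' ''u'') (at_var ''cl'' ''x''))))"
  define f where "f u v = (of_bool (e u v \<noteq> (P u = P v)) :: nat)" for u v
  define s0 where "s0 = put s ''cost'' 0 0"
  have inner: "sem (LFor ''x'' 0 c) s' ''cost'' 0 = s' ''cost'' 0 + (\<Sum>v<n. f u v)"
    if p': "prepared n e s'" and u: "s' ''u'' 0 = u" "u < n" and cl: "s' ''cl'' = P" for s' u
  proof (rule sem_LFor_inv[where I = "\<lambda>i s''. s'' ''cost'' 0 = s' ''cost'' 0 + (\<Sum>v<i. f u v)" and N = n])
    show "s' ''n'' 0 + 0 = n" using p' by (simp add: prepared_def)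
    show "put s' ''x'' 0 0 ''cost'' 0 = s' ''cost'' 0 + (\<Sum>v<0. f u v)" by (simp add: put_def)
    fix i s''
    assume i: "i < n" and frame: "\<And>y. y \<noteq> ''x'' \<Longrightarrow> y \<notin> asg c \<Longrightarrow> s'' y = s' y"
      and x: "s'' ''x'' 0 = i" and IH: "s'' ''cost'' 0 = s' ''cost'' 0 + (\<Sum>v<i. f u v)"
    have same: "s'' y = s' y" if "y \<noteq> ''x''" "y \<noteq> ''cost''" for y
      using frame[of y] that by (simp add: c_def)
    have p'': "prepared n e s''" using p' by (subst prepared_cong[of s'' s']) (simp_all add: same)
    have "val (edge (scalar ''u'') (scalar ''x'')) s'' = of_bool (e u i)"
      by (subst val_edge[OF p'']) (use u i in \<open>simp_all add: same x\<close>)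
    then have "val (NE (edge (scalar ''u'') (scalar ''x'')) (EQ (at_var ''cl'' ''u'') (at_var ''cl'' ''x''))) s'' = f u i"
      unfolding val_NE val_EQ by (simp add: same x u cl f_def)
    then have "bump ''x'' (sem c s'') ''cost'' 0 = s'' ''cost'' 0 + f u i"
      unfolding c_def sem.simps val.simps(3) by (simp add: bump_def put_def)
    then show "bump ''x'' (sem c s'') ''cost'' 0 = s' ''cost'' 0 + (\<Sum>v<Suc i. f u v)"
      using IH by simp
  qed (auto simp: c_def)
  have "sem (LFor ''u'' 0 (LFor ''x'' 0 c)) s0 ''cost'' 0 = (\<Sum>u<n. \<Sum>v<n. f u v)"
  proof (rule sem_LFor_inv[where I = "\<lambda>i s'. s' ''cost'' 0 = (\<Sum>u<i. \<Sum>v<n. f u v)" and N = n])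
    show "s0 ''n'' 0 + 0 = n" using p by (simp add: prepared_def s0_def put_def)
    show "put s0 ''u'' 0 0 ''cost'' 0 = (\<Sum>u<0. \<Sum>v<n. f u v)" by (simp add: put_def s0_def)
    fix i s'
    assume i: "i < n" and frame: "\<And>y. y \<noteq> ''u'' \<Longrightarrow> y \<notin> asg (LFor ''x'' 0 c) \<Longrightarrow> s' y = s0 y"
      and u: "s' ''u'' 0 = i" and IH: "s' ''cost'' 0 = (\<Sum>u<i. \<Sum>v<n. f u v)"
    have same: "s' y = s y" if "y \<notin> {''u'', ''x'', ''cost''}" for y
      using frame[of y] that by (simp add: c_def s0_def put_def)
    have p': "prepared n e s'" using p by (subst prepared_cong[of s' s]) (simp_all add: same)
    have "sem (LFor ''x'' 0 c) s' ''cost'' 0 = s' ''cost'' 0 + (\<Sum>v<n. f i v)"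
      by (rule inner[OF p' u i]) (simp add: same P_def)
    then show "bump ''u'' (sem (LFor ''x'' 0 c) s') ''cost'' 0 = (\<Sum>u<Suc i. \<Sum>v<n. f u v)"
      using IH by (simp add: bump_def put_other del: sem.simps)
  qed (auto simp: c_def)
  then show ?thesis
    unfolding lcount_def c_def s0_def by (simp only: sem.simps(2,3) val.simps pair_count_def f_def P_def)
qed

text \<open>The initial value \<open>n * n + 1\<close> of \<open>best\<close> says that nothing is
  stored yet. Every candidate costs at most \<open>n * n\<close> and thus beats it.\<close>

definition best_so_far :: "nat \<Rightarrow> nat \<Rightarrow> (nat \<Rightarrow> nat \<Rightarrow> bool) \<Rightarrow> store \<Rightarrow> bool" where
  "best_so_far k n e s \<longleftrightarrow> prepared n e s \<and> (s ''best'' 0 \<le> n * n \<longrightarrow>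
     (\<forall>u<n. s ''cluster'' u < k) \<and> pair_count e n (s ''cluster'') = s ''best'' 0)"

text \<open>The first two claims hold for invalid guesses too, since the cost is recounted from the
  labelling actually produced. Validity is needed only to predict that labelling.\<close>

lemma sem_ltry:
  assumes J: "best_so_far k n e s" and k: "k > 0"
  shows "best_so_far k n e (sem (ltry k m z) s)"
    and "sem (ltry k m z) s ''best'' 0 \<le> s ''best'' 0"
    and "(\<And>t. t < z \<Longrightarrow> valid_guess n K (\<lambda>i. s (guess_var (t * block k m + i)) 0)) \<Longrightarrow>
      sem (ltry k m z) s ''best'' 0 \<le> pair_count e n (\<lambda>u.
        let a = stages k m e n (\<lambda>t i. s (guess_var (t * block k m + i)) 0) z (\<lambda>_. k) u
        in if a < k then a else 0)"
proof -
  have p: "prepared n e s" using J by (simp add: best_so_far_def)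
  define s1 where "s1 = sem (lfill k) s"
  define s2 where "s2 = sem (lstages k m z) s1"
  define s3 where "s3 = sem (lfinish k) s2"
  define s4 where "s4 = sem lcount s3"
  define s5 where "s5 = sem lkeep s4"
  have s5: "sem (ltry k m z) s = s5"
    by (simp only: ltry_def sem.simps s1_def s2_def s3_def s4_def s5_def)
  have s1: "s1 y = s y" if "y \<noteq> ''u''" "y \<noteq> ''cl''" for y
    unfolding s1_def by (rule sem_frame) (use that in \<open>simp add: lfill_def\<close>)
  have s3: "s3 y = s2 y" if "y \<noteq> ''u''" "y \<noteq> ''cl''" for y
    unfolding s3_def by (rule sem_frame) (use that in \<open>simp add: lfinish_def\<close>)
  have s4: "s4 y = s3 y" if "y \<noteq> ''u''" "y \<noteq> ''x''" "y \<noteq> ''cost''" for y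
    unfolding s4_def by (rule sem_frame) (use that in \<open>simp add: lcount_def\<close>)
  have same: "s4 y = s y" if "y \<notin> {''sc'', ''x'', ''bi'', ''cl'', ''act'', ''u'', ''cost''}" for y
    using that by (simp add: s4 s3 s2_def sem_lstages_frame s1)
  have p1: "prepared n e s1" using p by (subst prepared_cong[of s1 s]) (simp_all add: s1)
  have p2: "prepared n e s2" using p1 by (subst prepared_cong[of s2 s1]) (simp_all add: s2_def sem_lstages_frame)
  have p3: "prepared n e s3" using p2 by (subst prepared_cong[of s3 s2]) (simp_all add: s3)
  have p4: "prepared n e s4" using p3 by (subst prepared_cong[of s4 s3]) (simp_all add: s4)
  have n: "s ''n'' 0 = n" "s2 ''n'' 0 = n" "s4 ''n'' 0 = n" using p p2 p4 by (simp_all add: prepared_def)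
  have cost: "s4 ''cost'' 0 = pair_count e n (s4 ''cl'')"
    using sem_lcount[OF p3] by (simp add: s4_def[symmetric] s4)
  have cl: "s4 ''cl'' v = (if s2 ''cl'' v < k then s2 ''cl'' v else 0)" if "v < n" for v
    using sem_lfinish[where s = s2 and k = k, OF n(2) that] by (simp add: s4 s3_def[symmetric])
  have s5_best: "s5 ''best'' 0 = min (s ''best'' 0) (pair_count e n (s4 ''cl''))"
  proof -
    have "sem lcopy s' ''best'' = s' ''best''" for s' by (rule sem_frame) (simp add: lcopy_def)
    then show ?thesis
      using same[of "''best''"] cost by (auto simp: s5_def lkeep_def put_def)
  qed
  have p5: "prepared n e s5"
  proof -
    have "s5 y = s4 y" if "y \<notin> {''best'', ''cluster'', ''u''}" for y
      unfolding s5_def by (rule sem_frame) (use that in \<open>auto simp: lkeep_def lcopy_def\<close>)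
    then show ?thesis using p4 by (subst prepared_cong[of s5 s4]) simp_all
  qed
  show "sem (ltry k m z) s ''best'' 0 \<le> s ''best'' 0" by (simp add: s5 s5_best)
  show "best_so_far k n e (sem (ltry k m z) s)"
  proof (cases "pair_count e n (s4 ''cl'') < s ''best'' 0")
    case True
    then have "s5 = sem lcopy (put s4 ''best'' 0 (s4 ''cost'' 0))"
      using same[of "''best''"] cost by (simp add: s5_def lkeep_def)
    then have clu: "s5 ''cluster'' v = s4 ''cl'' v" if "v < n" for v
      using that n(3) sem_lcopy[where s = "put s4 ''best'' 0 (s4 ''cost'' 0)" and n = n, OF _ that]
      by (simp add: put_def)
    then have "pair_count e n (s5 ''cluster'') = pair_count e n (s4 ''cl'')"
      by (rule pair_count_cong)
    then show ?thesis
      using True p5 clu cl k by (auto simp: s5 best_so_far_def s5_best)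
  next
    case False
    then have "s5 = s4" using same[of "''best''"] cost by (simp add: s5_def lkeep_def)
    then show ?thesis using J p4 by (simp add: s5 best_so_far_def same)
  qed
  let ?gs = "\<lambda>t i. s (guess_var (t * block k m + i)) 0"
  assume valid: "\<And>t. t < z \<Longrightarrow> valid_guess n K (?gs t)"
  have "s2 ''cl'' v = stages k m e n ?gs z (\<lambda>_. k) v" if "v < n" for v
    unfolding s2_def
  proof (rule sem_lstages[OF p1 _ _ valid that])
    show "s1 ''cl'' v = k" if "v < n" for v using sem_lfill[where s = s and k = k, OF n(1) that] by (simp add: s1_def)
    show "s1 (guess_var (t * block k m + i)) 0 = ?gs t i" for t i by (simp add: s1)
  qed
  then have "pair_count e n (s4 ''cl'') = pair_count e n (\<lambda>u.
        let a = stages k m e n ?gs z (\<lambda>_. k) u in if a < k then a else 0)"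
    by (intro pair_count_cong) (simp add: cl Let_def)
  then show "sem (ltry k m z) s ''best'' 0 \<le> pair_count e n (\<lambda>u.
        let a = stages k m e n ?gs z (\<lambda>_. k) u in if a < k then a else 0)"
    by (simp add: s5 s5_best)
qed

section \<open>Correctness\<close>

primrec lnest :: "nat \<Rightarrow> nat \<Rightarrow> lcom \<Rightarrow> lcom" where
  "lnest K 0 c = c"
| "lnest K (Suc j) c = LFor (guess_var j) K (lnest K j c)"

lemma asg_lnest: "asg (lnest K j c) = asg c \<union> guess_var ` {..<j}"
  by (induction j) (auto simp: lessThan_Suc)

lemma wf_lnest: "wf_loops c \<Longrightarrow> (\<And>i. guess_var i \<notin> asg c) \<Longrightarrow> wf_loops (lnest K j c)"
  by (induction j) (auto simp: asg_lnest)

lemma lnest_inv: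
  assumes c: "\<And>i. guess_var i \<notin> asg c" "''n'' \<notin> asg c"
    and step: "\<And>s. J s \<Longrightarrow> J (sem c s)" and put: "\<And>s i v. J s \<Longrightarrow> J (put s (guess_var i) 0 v)"
  shows "J s \<Longrightarrow> J (sem (lnest K j c) s)"
proof (induction j arbitrary: s)
  case 0
  then show ?case using step by simp
next
  case (Suc j)
  have "J (sem (LFor (guess_var j) K (lnest K j c)) s)"
    by (rule sem_LFor_inv[where I = "\<lambda>_. J" and N = "s ''n'' 0 + K"])
      (use c Suc put in \<open>auto simp: asg_lnest bump_def\<close>)
  then show ?case by (simp only: lnest.simps)
qed

text \<open>\<open>R\<close> stands for "as good as the try with vector \<open>G\<close>": it holds
  once \<open>G\<close> has been tried and persists afterwards. The outer loops carry the higher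
  indices, so the induction fixes the entries of \<open>G\<close> from above.\<close>

lemma lnest_covers:
  assumes c: "\<And>i. guess_var i \<notin> asg c" "''n'' \<notin> asg c"
    and J: "\<And>s. J s \<Longrightarrow> J (sem c s)" "\<And>s i v. J s \<Longrightarrow> J (put s (guess_var i) 0 v)"
      "\<And>s. J s \<Longrightarrow> s ''n'' 0 = n"
    and R: "\<And>s. J s \<Longrightarrow> R s \<Longrightarrow> R (sem c s)" "\<And>s i v. R s \<Longrightarrow> R (put s (guess_var i) 0 v)"
    and hit: "\<And>s. J s \<Longrightarrow> (\<And>i. s (guess_var i) 0 = G i) \<Longrightarrow> R (sem c s)"
    and G: "\<And>i. G i < n + K"
  shows "J s \<Longrightarrow> (\<forall>i\<ge>j. s (guess_var i) 0 = G i) \<Longrightarrow> R (sem (lnest K j c) s)"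
proof (induction j arbitrary: s)
  case 0
  then show ?case using hit by simp
next
  case (Suc j)
  define d where "d = lnest K j c"
  have dJ: "J (sem d s)" if "J s" for s unfolding d_def using lnest_inv[of c J] c J that by blast
  have dR: "R (sem d s)" if "J s" "R s" for s
    unfolding d_def using lnest_inv[of c "\<lambda>s. J s \<and> R s"] c J R that by blast
  have asg_d: "asg d = asg c \<union> guess_var ` {..<j}" by (simp add: d_def asg_lnest)
  \<comment> \<open>\<open>R\<close> is promised only after the iteration in which counter
    \<open>j\<close> equals \<open>G j\<close>.\<close>
  let ?I = "\<lambda>i s'. J s' \<and> (\<forall>l>j. s' (guess_var l) 0 = G l) \<and> (G j < i \<longrightarrow> R s')"
  have "?I (n + K) (sem (LFor (guess_var j) K d) s)"
  proof (rule sem_LFor_inv[where I = ?I])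
    show "guess_var j \<notin> asg d" "''n'' \<notin> asg d" "guess_var j \<noteq> ''n''" using c by (auto simp: asg_d)
    show "s ''n'' 0 + K = n + K" using J(3) Suc.prems by simp
    show "?I 0 (put s (guess_var j) 0 0)" using Suc.prems J(2) by (auto simp: put_def)
    fix i s'
    assume i: "s' (guess_var j) 0 = i" and I: "?I i s'"
    have keep: "sem d s' (guess_var l) = s' (guess_var l)" if "l > j" for l
      by (rule sem_frame) (use that c in \<open>auto simp: asg_d\<close>)
    have "R (sem d s')" if "G j < Suc i"
    proof (cases "G j = i")
      case True
      have "\<forall>l\<ge>j. s' (guess_var l) 0 = G l" using I i True by (auto simp: le_less)
      then show ?thesis unfolding d_def using Suc.IH I by blast
    next
      case False
      then show ?thesis using dR I that by auto
    qed
    then show "?I (Suc i) (bump (guess_var j) (sem d s'))"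
      using dJ I J(2) R(2) keep by (auto simp: bump_def put_other)
  qed
  then show ?case using G[of j] by (simp only: d_def lnest.simps)
qed

section \<open>Initialization\<close>

definition lrows :: lcom where
  "lrows = LFor ''u'' 0 (LSeq (LAssign ''row'' (scalar ''u'') (scalar ''acc''))
     (LAssign ''acc'' (Num 0) (Add (scalar ''acc'') (scalar ''n''))))"

text \<open>The input has 0 on the diagonal, whereas a similarity is reflexive.\<close>

definition ldiag :: lcom where
  "ldiag = LFor ''u'' 0 (LAssign ''label'' (Add (at_var ''row'' ''u'') (scalar ''u'')) (Num 1))"

text \<open>The running sum in \<open>acc\<close> that yields the row offsets ends at
  \<open>n * n\<close>, so the start value of \<open>best\<close> comes without
  multiplication.\<close>

definition lmain :: "nat \<Rightarrow> nat \<Rightarrow> nat \<Rightarrow> lcom" where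
  "lmain k m z = LSeq lrows (LSeq ldiag (LSeq (LAssign ''best'' (Num 0) (Add (scalar ''acc'') (Num 1)))
     (lnest (k + m + 2) (z * block k m) (ltry k m z))))"

lemma guess_notin_asg_ltry: "guess_var i \<notin> asg (ltry k m z)"
  using asg_ltry[of k m z] by auto

lemma n_notin_asg_ltry: "''n'' \<notin> asg (ltry k m z)"
  using asg_ltry[of k m z] by auto

lemma wf_lmain: "wf_loops (lmain k m z)"
  by (simp add: lmain_def lrows_def ldiag_def wf_lnest wf_ltry guess_notin_asg_ltry)

lemma n_notin_asg_lmain: "''n'' \<notin> asg (lmain k m z)"
  using n_notin_asg_ltry by (auto simp: lmain_def lrows_def ldiag_def asg_lnest)

lemma sem_lrows:
  assumes "s ''n'' 0 = n" "s ''acc'' 0 = 0"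
  shows "sem lrows s ''acc'' 0 = n * n" "u < n \<Longrightarrow> sem lrows s ''row'' u = u * n"
proof -
  let ?I = "\<lambda>i s'. s' ''acc'' 0 = i * n \<and> (\<forall>u<i. s' ''row'' u = u * n)"
  have "?I n (sem lrows s)"
    unfolding lrows_def
    by (rule sem_LFor_inv[where I = ?I])
      (use assms in \<open>auto simp: bump_def put_def less_Suc_eq\<close>)
  then show "sem lrows s ''acc'' 0 = n * n" "u < n \<Longrightarrow> sem lrows s ''row'' u = u * n" by blast+
qed

lemma sem_ldiag:
  assumes "s ''n'' 0 = n" "\<And>u. u < n \<Longrightarrow> s ''row'' u = u * n"
  shows "sem ldiag s ''label'' a = (if \<exists>u<n. a = u * n + u then 1 else s ''label'' a)"
proof -
  let ?I = "\<lambda>i s'. \<forall>a. s' ''label'' a = (if \<exists>u<i. a = u * n + u then 1 else s ''label'' a)"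
  define c where "c = LAssign ''label'' (Add (at_var ''row'' ''u'') (scalar ''u'')) (Num 1)"
  have "?I n (sem (LFor ''u'' 0 c) s)"
  proof (rule sem_LFor_inv[where I = ?I and N = n])
    show "s ''n'' 0 + 0 = n" using assms(1) by simp
    show "?I 0 (put s ''u'' 0 0)" by (simp add: put_def)
    fix i s'
    assume i: "i < n" and frame: "\<And>y. y \<noteq> ''u'' \<Longrightarrow> y \<notin> asg c \<Longrightarrow> s' y = s y"
      and u: "s' ''u'' 0 = i" and IH: "?I i s'"
    have "s' ''row'' = s ''row''" by (rule frame) (simp_all add: c_def)
    then have "sem c s' = put s' ''label'' (i * n + i) 1" using assms(2)[OF i] u by (simp add: c_def)
    then have "bump ''u'' (sem c s') ''label'' a = (if a = i * n + i then 1 else s' ''label'' a)" for a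
      by (simp add: bump_def put_def)
    then show "?I (Suc i) (bump ''u'' (sem c s'))" by (simp add: IH less_Suc_eq ex_disj_distrib conj_disj_distribR) blast
  qed (simp_all add: c_def)
  then show ?thesis by (simp add: ldiag_def c_def del: sem.simps)
qed

section \<open>Disagreements as ordered pairs\<close>

definition plus_or_eq :: "(nat set \<Rightarrow> sign) \<Rightarrow> nat \<Rightarrow> nat \<Rightarrow> bool" where
  "plus_or_eq lab u v \<longleftrightarrow> u = v \<or> lab {u, v} = Plus"

lemma similarity_plus_or_eq: "similarity (plus_or_eq lab)"
  by (auto simp: similarity_def plus_or_eq_def insert_commute)

lemma matrix_index:
  fixes u v n :: nat
  assumes "u < n" "v < n"
  shows "(u * n + v) div n = u" "(u * n + v) mod n = v" "u * n + v < n * n"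
proof -
  show "(u * n + v) div n = u" "(u * n + v) mod n = v" using assms by simp_all
  have "u * n + v < Suc u * n" using assms by simp
  also have "\<dots> \<le> n * n" using assms by (intro mult_right_mono) auto
  finally show "u * n + v < n * n" .
qed

lemma matrix_index_eq:
  fixes u v w n :: nat
  assumes "u < n" "v < n" "w < n" "u * n + v = w * n + w"
  shows "u = v"
proof -
  have "u = w" "v = w"
    using matrix_index(1,2)[OF assms(1,2)] matrix_index(1,2)[OF assms(3,3)] assms(4) by simp_all
  then show ?thesis by simp
qed

lemma prepared_init:
  assumes "s = sem (LAssign ''best'' (Num 0) (Add (scalar ''acc'') (Num 1))) (sem ldiag (sem lrows (instance_store n lab)))"
  shows "best_so_far k n (plus_or_eq lab) s" "s (guess_var i) 0 = 0"
proof -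
  let ?s0 = "instance_store n lab"
  define s1 where "s1 = sem lrows ?s0"
  define s2 where "s2 = sem ldiag s1"
  have n0: "?s0 ''n'' 0 = n" "?s0 ''acc'' 0 = 0" by (simp_all add: instance_store_def)
  have s1: "s1 y = ?s0 y" if "y \<notin> {''u'', ''row'', ''acc''}" for y
    unfolding s1_def by (rule sem_frame) (use that in \<open>simp add: lrows_def\<close>)
  have s2: "s2 y = s1 y" if "y \<notin> {''u'', ''label''}" for y
    unfolding s2_def by (rule sem_frame) (use that in \<open>simp add: ldiag_def\<close>)
  have n1: "s1 ''n'' 0 = n" using n0 by (simp add: s1)
  have row: "s1 ''row'' u = u * n" if "u < n" for u
    unfolding s1_def by (rule sem_lrows(2)[where s = ?s0 and n = n, OF n0 that])
  have acc: "s1 ''acc'' 0 = n * n" unfolding s1_def by (rule sem_lrows(1)[where s = ?s0 and n = n, OF n0])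
  have diag: "s2 ''label'' a = (if \<exists>u<n. a = u * n + u then 1 else s1 ''label'' a)" for a
    unfolding s2_def by (rule sem_ldiag[where s = s1 and n = n, OF n1]) (rule row)
  have label: "s2 ''label'' (u * n + v) = of_bool (plus_or_eq lab u v)" if uv: "u < n" "v < n" for u v
  proof (cases "u = v")
    case True
    then have "\<exists>w<n. u * n + v = w * n + w" using uv by blast
    then show ?thesis using True by (simp add: diag plus_or_eq_def)
  next
    case False
    have "\<not> (\<exists>w<n. u * n + v = w * n + w)"
    proof
      assume "\<exists>w<n. u * n + v = w * n + w"
      then obtain w where "w < n" "u * n + v = w * n + w" by blast
      from matrix_index_eq[OF uv this] show False using False by contradiction
    qed
    then have "s2 ''label'' (u * n + v) = ?s0 ''label'' (u * n + v)"
      by (simp only: diag if_False) (simp add: s1)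
    also have "\<dots> = of_bool (plus_or_eq lab u v)"
      using False matrix_index[OF uv] by (simp add: instance_store_def plus_or_eq_def)
    finally show ?thesis .
  qed
  have s: "s = put s2 ''best'' 0 (n * n + 1)"
    using acc by (simp add: assms s1_def[symmetric] s2_def[symmetric] s2)
  have "prepared n (plus_or_eq lab) s2"
    unfolding prepared_def using n1 row label by (simp add: s2)
  then have "prepared n (plus_or_eq lab) s"
    by (subst prepared_cong[of s s2]) (simp_all add: s put_def)
  then show "best_so_far k n (plus_or_eq lab) s" by (simp add: best_so_far_def s put_def)
  have "s (guess_var i) = ?s0 (guess_var i)" using s1[of "guess_var i"] s2[of "guess_var i"] by (simp add: s put_def)
  then show "s (guess_var i) 0 = 0" by (simp add: instance_store_def)
qed

lemma pair_count_disagreements: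
  assumes same: "\<And>u v. u < n \<Longrightarrow> v < n \<Longrightarrow> same_cluster P {u, v} \<longleftrightarrow> D u = D v"
  shows "pair_count (plus_or_eq lab) n D = 2 * disagreements {..<n} lab P"
proof -
  define X where "X = {x \<in> edges {..<n}. \<not> agreement lab P x}"
  have X2: "card x = 2" "x \<subseteq> {..<n}" if "x \<in> X" for x using that by (auto simp: X_def edges_def)
  have fX: "finite X" by (rule finite_subset[of _ "Pow {..<n}"]) (use X2 in auto)
  \<comment> \<open>Double counting: the fibre over an edge consists of its two orderings, and the
    diagonal lies over no edge.\<close>
  define F where "F x = {p. {fst p, snd p} = x}" for x :: "nat set"
  have F: "card (F x) = 2 \<and> finite (F x)" if x: "x \<in> X" for x
  proof -
    obtain a b where ab: "x = {a, b}" "a \<noteq> b" using X2(1)[OF x] by (auto simp: card_2_iff)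
    have "F x = {(a, b), (b, a)}" using ab by (auto simp: F_def doubleton_eq_iff)
    then show ?thesis using ab by simp
  qed
  have iff: "plus_or_eq lab u v \<noteq> (D u = D v) \<longleftrightarrow> {u, v} \<in> X" if uv: "u < n" "v < n" for u v
  proof (cases "u = v")
    case True
    then show ?thesis by (auto simp: plus_or_eq_def X_def edges_def)
  next
    case False
    then have "{u, v} \<in> edges {..<n}" using uv by (simp add: edges_def)
    then show ?thesis
      using False same[OF uv] by (cases "lab {u, v}") (auto simp: X_def plus_or_eq_def agreement_def)
  qed
  have "pair_count (plus_or_eq lab) n D
      = (\<Sum>p\<in>{..<n} \<times> {..<n}. of_bool (plus_or_eq lab (fst p) (snd p) \<noteq> (D (fst p) = D (snd p))))"
    by (simp only: pair_count_def sum.cartesian_product case_prod_unfold)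
  also have "\<dots> = card ({..<n} \<times> {..<n} \<inter> {p. plus_or_eq lab (fst p) (snd p) \<noteq> (D (fst p) = D (snd p))})"
    by simp
  also have "{..<n} \<times> {..<n} \<inter> {p. plus_or_eq lab (fst p) (snd p) \<noteq> (D (fst p) = D (snd p))} = (\<Union>x\<in>X. F x)"
  proof (rule set_eqI)
    fix p :: "nat \<times> nat"
    obtain u v where p: "p = (u, v)" by (cases p)
    have "p \<in> (\<Union>x\<in>X. F x) \<longleftrightarrow> {u, v} \<in> X" by (simp add: F_def p)
    also have "\<dots> \<longleftrightarrow> u < n \<and> v < n \<and> {u, v} \<in> X" using X2(2)[of "{u, v}"] by auto
    also have "\<dots> \<longleftrightarrow> u < n \<and> v < n \<and> plus_or_eq lab u v \<noteq> (D u = D v)" using iff by blast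
    finally show "p \<in> {..<n} \<times> {..<n} \<inter> {p. plus_or_eq lab (fst p) (snd p) \<noteq> (D (fst p) = D (snd p))}
        \<longleftrightarrow> p \<in> (\<Union>x\<in>X. F x)" by (simp add: p)
  qed
  also have "card \<dots> = (\<Sum>x\<in>X. card (F x))"
    using fX F by (intro card_UN_disjoint) (auto simp: F_def)
  also have "\<dots> = (\<Sum>x\<in>X. 2)" using F by (intro sum.cong) auto
  finally show ?thesis by (simp add: disagreements_def X_def)
qed

text \<open>The at most \<open>k\<close> parts are numbered injectively below \<open>k\<close>;
  disjointness makes the part of a vertex unique.\<close>

lemma labelling_of_clustering:
  fixes n k :: nat
  assumes "P \<in> k_clusterings k {..<n}"
  shows "\<exists>D. (\<forall>u<n. D u < k) \<and> (\<forall>u<n. \<forall>v<n. same_cluster P {u, v} \<longleftrightarrow> D u = D v)"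
proof -
  have part: "partition_on {..<n} P" and card: "card P \<le> k"
    using assms by (auto simp: k_clusterings_def)
  have "finite P" using finite_elements[OF _ part] by simp
  then obtain f where f: "inj_on f P" "f ` P \<subseteq> {..<k}"
    using card card_le_inj[of P "{..<k}"] by auto
  have "\<forall>u. \<exists>c. u < n \<longrightarrow> c \<in> P \<and> u \<in> c" using partition_onD1[OF part] by blast
  then obtain C where C: "\<And>u. u < n \<Longrightarrow> C u \<in> P \<and> u \<in> C u" by metis
  have C_eq: "C u = c" if "c \<in> P" "u \<in> c" "u < n" for u c
    using disjointD[OF partition_onD2[OF part], of "C u" c] C[of u] that by blast
  have "same_cluster P {u, v} \<longleftrightarrow> f (C u) = f (C v)" if "u < n" "v < n" for u v
  proof -
    have "f (C u) = f (C v) \<longleftrightarrow> C u = C v" using C that f(1) by (auto dest: inj_onD)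
    also have "\<dots> \<longleftrightarrow> same_cluster P {u, v}"
    proof
      assume "C u = C v"
      then have "{u, v} \<subseteq> C u" using C[OF that(1)] C[OF that(2)] by simp
      then show "same_cluster P {u, v}" using C[OF that(1)] by (auto simp: same_cluster_def)
    next
      assume "same_cluster P {u, v}"
      then obtain c where "c \<in> P" "u \<in> c" "v \<in> c" by (auto simp: same_cluster_def)
      then show "C u = C v" using C_eq[of c u] C_eq[of c v] that by simp
    qed
    finally show ?thesis by (rule sym)
  qed
  moreover have "f (C u) < k" if "u < n" for u using C[OF that] f(2) by auto
  ultimately show ?thesis by (intro exI[of _ "\<lambda>u. f (C u)"]) simp
qed

lemma output_clustering_k:
  assumes "\<And>u. u < n \<Longrightarrow> s ''cluster'' u < k"
  shows "output_clustering n s \<in> k_clusterings k {..<n}"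
    and "u < n \<Longrightarrow> v < n \<Longrightarrow> same_cluster (output_clustering n s) {u, v} \<longleftrightarrow> s ''cluster'' u = s ''cluster'' v"
proof -
  have "output_clustering n s \<subseteq> (\<lambda>a. {u. u < n \<and> s ''cluster'' u = a}) ` {..<k}"
    using assms by (auto simp: output_clustering_def)
  then have "card (output_clustering n s) \<le> card ((\<lambda>a. {u. u < n \<and> s ''cluster'' u = a}) ` {..<k})"
    by (intro card_mono) auto
  also have "\<dots> \<le> k" using card_image_le[of "{..<k}"] by simp
  finally show "output_clustering n s \<in> k_clusterings k {..<n}"
    by (simp add: k_clusterings_def partition_on_output_clustering)
  show "u < n \<Longrightarrow> v < n \<Longrightarrow> same_cluster (output_clustering n s) {u, v} \<longleftrightarrow> s ''cluster'' u = s ''cluster'' v"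
    by (auto simp: same_cluster_def output_clustering_def)
qed

theorem theorem7:
  fixes k :: nat and \<epsilon> :: real
  assumes "k \<ge> 2" and "\<epsilon> > 0"
  shows "\<exists>(c :: com) (p :: nat poly). \<forall>(n :: nat) (lab :: nat set \<Rightarrow> sign).
    halts_within (poly p n) c (instance_store n lab) \<and>
    measure_pmf.prob (outcome (poly p n) c (instance_store n lab))
      {s. output_clustering n s \<in> k_clusterings k {..<n} \<and>
          real (disagreements {..<n} lab (output_clustering n s)) \<le> (1 + \<epsilon>) * real (OPT k {..<n} lab)}
      \<ge> 1 - 1 / real n"
proof -
  \<comment> \<open>The composition of the two factors in the induction needs an error of at most
    1.\<close>
  define \<epsilon>' where "\<epsilon>' = min \<epsilon> 1"
  have \<epsilon>': "0 < \<epsilon>'" "\<epsilon>' \<le> 1" "\<epsilon>' \<le> \<epsilon>" using assms by (simp_all add: \<epsilon>'_def)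
  obtain m z where mz: "approximable k k \<epsilon>' m z"
    using approximable_exists[OF \<epsilon>'(1,2), of k k] by blast
  define prog where "prog = lmain k m z"
  have correct: "output_clustering n s \<in> k_clusterings k {..<n} \<and>
      real (disagreements {..<n} lab (output_clustering n s)) \<le> (1 + \<epsilon>) * real (OPT k {..<n} lab)"
    if s: "s = sem prog (instance_store n lab)" for n lab s
  proof -
    define e where "e = plus_or_eq lab"
    have ne: "k_clusterings k {..<n} \<noteq> {}" using k_clusterings_nonempty[of k] assms(1) by simp
    have "OPT k {..<n} lab \<in> disagreements {..<n} lab ` k_clusterings k {..<n}"
      unfolding OPT_def using ne by (intro Min_in) (simp_all add: finite_k_clusterings)
    then obtain P where P: "P \<in> k_clusterings k {..<n}" "disagreements {..<n} lab P = OPT k {..<n} lab"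
      by auto
    from labelling_of_clustering[OF P(1)]
    obtain D where D: "\<forall>u<n. D u < k" "\<forall>u<n. \<forall>v<n. same_cluster P {u, v} \<longleftrightarrow> D u = D v" by blast
    have D_count: "pair_count e n D = 2 * OPT k {..<n} lab"
      unfolding e_def P(2)[symmetric] using D(2) by (intro pair_count_disagreements) blast
    \<comment> \<open>The search starts with every vertex pending and all \<open>k\<close> labels
      available.\<close>
    have "\<exists>Q'. reach k m (k + m + 2) e n z (\<lambda>_. k) Q' \<and> (\<forall>u. u \<notin> {..<n} \<longrightarrow> Q' u = k) \<and> (\<forall>u\<in>{..<n}. Q' u \<in> {..<k})
       \<and> pair_cost e {..<n} Q' \<le> (1 + \<epsilon>') * pair_cost e {..<n} D"
      by (rule approximableD[OF mz]) (use D(1) in \<open>auto simp: e_def similarity_plus_or_eq\<close>)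
    then obtain Q' where Q': "reach k m (k + m + 2) e n z (\<lambda>_. k) Q'" "\<forall>u\<in>{..<n}. Q' u \<in> {..<k}"
      "pair_cost e {..<n} Q' \<le> (1 + \<epsilon>') * pair_cost e {..<n} D" by blast
    from reach_stages[OF Q'(1)] obtain gs where gs: "\<And>t. t < z \<Longrightarrow> valid_guess n (k + m + 2) (gs t)"
      "Q' = stages k m e n gs z (\<lambda>_. k)" by blast
    have "\<exists>G. (\<forall>x. G x < n + (k + m + 2)) \<and> (\<forall>x\<ge>z * block k m. G x = 0) \<and>
      (\<forall>t<z. valid_guess n (k + m + 2) (\<lambda>i. G (t * block k m + i))) \<and>
      (\<forall>Q. stages k m e n (\<lambda>t i. G (t * block k m + i)) z Q = stages k m e n gs z Q)"
      by (rule guess_vector_exists, erule gs(1)) simp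
    then obtain G where "(\<forall>x. G x < n + (k + m + 2)) \<and> (\<forall>x\<ge>z * block k m. G x = 0) \<and>
      (\<forall>t<z. valid_guess n (k + m + 2) (\<lambda>i. G (t * block k m + i))) \<and>
      (\<forall>Q. stages k m e n (\<lambda>t i. G (t * block k m + i)) z Q = stages k m e n gs z Q)"
      by (rule exE)
    then have G: "\<And>x. G x < n + (k + m + 2)" "\<And>x. x \<ge> z * block k m \<Longrightarrow> G x = 0"
      "\<And>t. t < z \<Longrightarrow> valid_guess n (k + m + 2) (\<lambda>i. G (t * block k m + i))"
      "stages k m e n (\<lambda>t i. G (t * block k m + i)) z (\<lambda>_. k) = Q'"
      unfolding gs(2) by blast+
    define s0 where "s0 = sem (LAssign ''best'' (Num 0) (Add (scalar ''acc'') (Num 1)))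
      (sem ldiag (sem lrows (instance_store n lab)))"
    have s_nest: "s = sem (lnest (k + m + 2) (z * block k m) (ltry k m z)) s0"
      by (simp only: s prog_def lmain_def s0_def sem.simps)
    have J0: "best_so_far k n e s0" and guess0: "s0 (guess_var i) 0 = 0" for i
      using prepared_init[OF s0_def] by (simp_all add: e_def)
    have k: "k > 0" using assms(1) by simp
    have J_put: "best_so_far k n e (put s (guess_var i) 0 v)" if "best_so_far k n e s" for s i v
    proof -
      have "prepared n e (put s (guess_var i) 0 v) = prepared n e s"
        by (rule prepared_cong) (simp_all add: put_other)
      then show ?thesis using that by (simp add: best_so_far_def put_other)
    qed
    have J_step: "best_so_far k n e (sem (ltry k m z) s)" if "best_so_far k n e s" for s
      by (rule sem_ltry(1)[OF that k])
    let ?R = "\<lambda>s. s ''best'' 0 \<le> pair_count e n Q'"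
    have "?R (sem (lnest (k + m + 2) (z * block k m) (ltry k m z)) s0)"
    proof (rule lnest_covers[where J = "best_so_far k n e" and R = ?R and G = G and n = n])
      show "s ''n'' 0 = n" if "best_so_far k n e s" for s
        using that by (simp add: best_so_far_def prepared_def)
      show "?R (sem (ltry k m z) s)" if "best_so_far k n e s" "?R s" for s
        using sem_ltry(2)[OF that(1) k, of m z] that(2) by (rule order_trans)
      show "?R (put s (guess_var i) 0 v)" if "?R s" for s i v using that by (simp add: put_other)
      show "?R (sem (ltry k m z) s)" if "best_so_far k n e s" "\<And>i. s (guess_var i) 0 = G i" for s
      proof -
        have "sem (ltry k m z) s ''best'' 0 \<le> pair_count e n (\<lambda>u. let a = Q' u in if a < k then a else 0)"
          using sem_ltry(3)[OF that(1) k, of z "k + m + 2" m] G(3,4) by (simp add: that(2))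
        also have "\<dots> = pair_count e n Q'" using Q'(2) by (intro pair_count_cong) simp
        finally show ?thesis .
      qed
      show "\<forall>i\<ge>z * block k m. s0 (guess_var i) 0 = G i" using G(2) guess0 by simp
    qed (fact guess_notin_asg_ltry n_notin_asg_ltry J_step J_put G(1) J0)+
    then have best: "s ''best'' 0 \<le> pair_count e n Q'" by (simp only: s_nest)
    have "best_so_far k n e s"
      unfolding s_nest
      by (rule lnest_inv[where J = "best_so_far k n e"])
        (fact guess_notin_asg_ltry n_notin_asg_ltry J_step J_put J0)+
    \<comment> \<open>So \<open>best\<close> has left its start value and \<open>cluster\<close>
      holds a genuine candidate of that cost.\<close>
    moreover have "s ''best'' 0 \<le> n * n" using best pair_count_le[of e n Q'] by simp
    ultimately have out: "\<And>u. u < n \<Longrightarrow> s ''cluster'' u < k" "pair_count e n (s ''cluster'') = s ''best'' 0"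
      by (auto simp: best_so_far_def)
    have "2 * disagreements {..<n} lab (output_clustering n s) = pair_count e n (s ''cluster'')"
      unfolding e_def by (rule pair_count_disagreements[symmetric]) (rule output_clustering_k(2)[where s = s and n = n and k = k, OF out(1)])
    then have "2 * real (disagreements {..<n} lab (output_clustering n s)) = real (s ''best'' 0)"
      using out(2) by simp
    also have "\<dots> \<le> real (pair_count e n Q')" using best by simp
    also have "\<dots> \<le> (1 + \<epsilon>') * real (pair_count e n D)" using Q'(3) by (simp only: pair_count_cost)
    also have "\<dots> \<le> (1 + \<epsilon>) * real (pair_count e n D)" using \<epsilon>' by (intro mult_right_mono) auto
    finally have "real (disagreements {..<n} lab (output_clustering n s)) \<le> (1 + \<epsilon>) * real (OPT k {..<n} lab)"
      by (simp add: D_count)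
    then show ?thesis using output_clustering_k(1)[where s = s and n = n and k = k, OF out(1)] by blast
  qed
  show ?thesis
  proof (intro exI[of _ "compile prog"] exI[of _ "time prog"] allI conjI)
    fix n lab
    have n: "instance_store n lab ''n'' 0 = n" by (simp add: instance_store_def)
    note run = compile_outcome[where s = "instance_store n lab" and n = n and c = prog,
        unfolded prog_def, OF wf_lmain n_notin_asg_lmain n, folded prog_def]
    show "halts_within (poly (time prog) n) (compile prog) (instance_store n lab)" by (rule run(1))
    \<comment> \<open>The probability is 1, which also covers \<open>n = 0\<close>, where
      \<open>1 / real n\<close> is 0.\<close>
    show "1 - 1 / real n \<le> measure_pmf.prob (outcome (poly (time prog) n) (compile prog) (instance_store n lab))
      {s. output_clustering n s \<in> k_clusterings k {..<n} \<and>
          real (disagreements {..<n} lab (output_clustering n s)) \<le> (1 + \<epsilon>) * real (OPT k {..<n} lab)}"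
      using correct[OF HOL.refl, of n lab] unfolding run(2) by (simp add: measure_return_pmf)
  qed
qed

end
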